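(* For every real $\lambda$ with $0<\lambda<1$, there exists a class of sparse node-weighted graphs (an infinite family of graphs $G$, with $n\to\infty$ nodes and $O(n)$ edges, each equipped with positive node weights and an initial two-coloring) such that, under Switching Rule II with parameter $\lambda$, the minority process on these graphs has stabilization time $2^{\Theta(n)}$ in the benevolent models, i.e., both in the Sequential Benevolent model $SB$ and in the Concurrent Benevolent model $CB$.
   Context: Let $G=(V,E)$ be a simple undirected graph with $n$ nodes and a positive node-weight function $w:V\to\mathbb{R}^+$. For $S\subseteq V$ write $W_S=\sum_{u\in S}w(u)$, and let $N(v)$ denote the neighborhood of $v$. A coloring is a map $C:V\to\{\text{black},\text{white}\}$. Under a coloring, $N_S(v)=\{u\in N(v): C(u)=C(v)\}$ and $N_O(v)=N(v)\setminus N_S(v)$. Switching Rule II (proportional switching) with parameter $\lambda\in(0,1)$: a node $v$ is switchable if $W_{N_S(v)}-W_{N_O(v)}\ge \lambda\cdot W_{N(v)}$; switching $v$ means changing its color to the other color. A minority process is a sequence of colorings (states) $S_0,S_1,\dots$, where $S_0$ is the given initial coloring and each $S_i$ is obtained from $S_{i-1}$ by switching some set of nodes that are switchable in $S_{i-1}$. A state is stable if it has no switchable node; the stabilization time is the number of steps until a stable state is reached. In model $SB$ (Sequential Benevolent), exactly one switchable node switches in each step, chosen by a benevolent player who aims to minimize the stabilization time. In model $CB$ (Concurrent Benevolent), in each step the benevolent player may switch any nonempty set of currently switchable nodes simultaneously, aiming to minimize the stabilization time. Thus in these models the stabilization time is the minimum, over all valid runs of the respective model, of the number of steps until a stable state is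 reached. *)

theory Defs
  imports
    Complex_Main
    "HOL-Library.Ramsey"
    "HOL-Library.Extended_Real"
    "HOL-Library.Landau_Symbols"
begin

definition simple_graph :: "'a set \<Rightarrow> 'a set set \<Rightarrow> bool" where
  "simple_graph V E \<longleftrightarrow> finite V \<and> E \<subseteq> nsets V 2"

definition neighborhood :: "'a set set \<Rightarrow> 'a \<Rightarrow> 'a set" where
  "neighborhood E v = {u. {u, v} \<in> E}"

text \<open>Colorings are total functions; a minority process never changes or reads a value
  outside the vertex set.\<close>

datatype color = Black | White

fun other_color :: "color \<Rightarrow> color" where
  "other_color Black = White"
| "other_color White = Black"

definition same_neighbors :: "'a set set \<Rightarrow> ('a \<Rightarrow> color) \<Rightarrow> 'a \<Rightarrow> 'a set" where
  "same_neighbors E C v = {u \<in> neighborhood E v. C u = C v}"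

definition opposite_neighbors :: "'a set set \<Rightarrow> ('a \<Rightarrow> color) \<Rightarrow> 'a \<Rightarrow> 'a set" where
  "opposite_neighbors E C v = neighborhood E v - same_neighbors E C v"

definition switchable ::
  "'a set \<Rightarrow> 'a set set \<Rightarrow> ('a \<Rightarrow> real) \<Rightarrow> real \<Rightarrow> ('a \<Rightarrow> color) \<Rightarrow> 'a \<Rightarrow> bool" where
  "switchable V E w lam C v \<longleftrightarrow>
     v \<in> V \<and>
     sum w (same_neighbors E C v) - sum w (opposite_neighbors E C v)
       \<ge> lam * sum w (neighborhood E v)"

definition stable ::
  "'a set \<Rightarrow> 'a set set \<Rightarrow> ('a \<Rightarrow> real) \<Rightarrow> real \<Rightarrow> ('a \<Rightarrow> color) \<Rightarrow> bool" where
  "stable V E w lam C \<longleftrightarrow> (\<forall>v \<in> V. \<not> switchable V E w lam C v)"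

definition switch :: "'a set \<Rightarrow> ('a \<Rightarrow> color) \<Rightarrow> 'a \<Rightarrow> color" where
  "switch A C v = (if v \<in> A then other_color (C v) else C v)"

text \<open>\<open>SB\<close> is the sequential and \<open>CB\<close> the concurrent benevolent model.\<close>

datatype model = SB | CB

fun admissible :: "model \<Rightarrow> 'a set \<Rightarrow> bool" where
  "admissible SB A \<longleftrightarrow> is_singleton A"
| "admissible CB A \<longleftrightarrow> A \<noteq> {}"

text \<open>Only the states \<open>S 0, \<dots>, S T\<close> of \<open>S\<close> belong to the run.\<close>

definition minority_run ::
  "model \<Rightarrow> 'a set \<Rightarrow> 'a set set \<Rightarrow> ('a \<Rightarrow> real) \<Rightarrow> real \<Rightarrow> ('a \<Rightarrow> color) \<Rightarrow>
   nat \<Rightarrow> (nat \<Rightarrow> 'a \<Rightarrow> color) \<Rightarrow> bool" where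
  "minority_run M V E w lam C0 T S \<longleftrightarrow>
     S 0 = C0 \<and>
     (\<forall>i < T. \<exists>A. admissible M A \<and> A \<subseteq> {v. switchable V E w lam (S i) v} \<and>
                   S (Suc i) = switch A (S i))"

text \<open>The benevolent player minimizes over all runs ending in a stable state; the value is
  \<open>\<infinity>\<close> if there is no such run.\<close>

definition stabilization_time ::
  "model \<Rightarrow> 'a set \<Rightarrow> 'a set set \<Rightarrow> ('a \<Rightarrow> real) \<Rightarrow> real \<Rightarrow> ('a \<Rightarrow> color) \<Rightarrow> enat" where
  "stabilization_time M V E w lam C0 =
     Inf {enat T | T. \<exists>S. minority_run M V E w lam C0 T S \<and> stable V E w lam (S T)}"

text \<open>\<open>T = 2\<^bsup>\<Theta>(n)\<^esup>\<close>; in particular every \<open>T k\<close> is finite.\<close>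

definition two_to_bigtheta :: "(nat \<Rightarrow> enat) \<Rightarrow> (nat \<Rightarrow> nat) \<Rightarrow> bool" where
  "two_to_bigtheta T n \<longleftrightarrow>
     (\<exists>f :: nat \<Rightarrow> real. f \<in> \<Theta>(\<lambda>k. real (n k)) \<and>
        (\<forall>k. ereal_of_enat (T k) = ereal (2 powr f k)))"

end

theory Submission
  imports Defs "HOL-Library.Countable"
begin

text \<open>
  Put \<open>kap = (1 - lam) / 2\<close>: a node may switch iff the opposite colour has weight at most \<open>kap\<close> times
  its neighbourhood weight, so between two switches of a node almost all of its neighbourhood must
  switch. Take \<open>p\<close> with \<open>1 < kap * p < 2\<close>, and let an output node be driven by \<open>p\<close> equal gates, of which
  one may be missing at a time. If the missing gate moves around the ring of gates, every gate skips
  two of every \<open>p\<close> phases: the output switches \<open>p\<close> times while each gate, and hence the input of the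
  ring, switches only \<open>p - 2\<close> times. Chaining \<open>L\<close> such rings multiplies the number of switches by
  \<open>p / (p - 2)\<close> per ring.

  The benevolent player cannot shortcut this, because each gate waits for an acknowledgement of the
  next gate (which forces the missing gate to move) and of the ring below (which forces every output
  switch to be processed completely). An invariant on the switch counts holds for arbitrary concurrent
  steps, and a state satisfying it is stable only if every ring has used up its input. Conversely the
  total weight of conflicting edges decreases in sequential steps, so no state repeats and
  \<open>2 ^ n\<close> steps suffice.
\<close>

section \<open>Minority processes on general graphs\<close>

lemma neighborhood_subset:
  assumes "simple_graph V E"
  shows "neighborhood E v \<subseteq> V" "finite (neighborhood E v)" "v \<notin> neighborhood E v"
proof -
  have E: "e \<subseteq> V \<and> card e = 2" if "e \<in> E" for e
    using assms that by (auto simp: simple_graph_def nsets_def)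
  show sub: "neighborhood E v \<subseteq> V" using E by (auto simp: neighborhood_def)
  then show "finite (neighborhood E v)"
    using assms finite_subset by (auto simp: simple_graph_def)
  show "v \<notin> neighborhood E v" using E[of "{v}"] by (auto simp: neighborhood_def)
qed

lemma sum_same_opposite:
  assumes "finite (neighborhood E v)"
  shows "sum w (same_neighbors E C v) + sum w (opposite_neighbors E C v) = sum w (neighborhood E v)"
  unfolding opposite_neighbors_def
  using sum.subset_diff[OF _ assms, of "same_neighbors E C v" w]
  by (simp add: same_neighbors_def add.commute)

text \<open>Same and opposite weights add up to the neighbourhood weight, so the rule becomes a
  bound on the opposite weight alone. All readiness arguments use this form.\<close>

lemma switchable_iff_opposite:
  assumes "finite (neighborhood E v)"
  shows "switchable V E w lam C v \<longleftrightarrow>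
    v \<in> V \<and> sum w (opposite_neighbors E C v) \<le> (1 - lam) / 2 * sum w (neighborhood E v)"
  unfolding switchable_def sum_same_opposite[OF assms, of w C, symmetric] by (auto simp: field_simps)

section \<open>A potential for sequential switching and the upper bound\<close>

definition conflict :: "'a set set \<Rightarrow> ('a \<Rightarrow> real) \<Rightarrow> ('a \<Rightarrow> color) \<Rightarrow> real" where
  "conflict E w C = (\<Sum>e\<in>E. if \<exists>c. \<forall>v\<in>e. C v = c then prod w e else 0)"

text \<open>With products of end weights on monochromatic edges, the edges at \<open>v\<close>
  contribute \<open>w v\<close> times the same-coloured weight around \<open>v\<close>. Switching
  \<open>v\<close> therefore lowers the total by \<open>w v\<close> times the difference that the
  switching rule tests.\<close>

lemma conflict_split:
  assumes "simple_graph V E"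
  shows "conflict E w C = (\<Sum>e\<in>{e\<in>E. v \<notin> e}. if \<exists>c. \<forall>u\<in>e. C u = c then prod w e else 0)
    + w v * sum w (same_neighbors E C v)"
proof -
  let ?f = "\<lambda>e. if \<exists>c. \<forall>u\<in>e. C u = c then prod w e else 0"
  let ?N = "neighborhood E v"
  have card2: "card e = 2" if "e \<in> E" for e
    using assms that by (auto simp: simple_graph_def nsets_def)
  have finE: "finite E"
    using assms by (auto simp: simple_graph_def finite_imp_finite_nsets intro: finite_subset)
  have img: "{e\<in>E. v \<in> e} = (\<lambda>u. {u, v}) ` ?N"
  proof (rule set_eqI, rule iffI)
    fix e assume "e \<in> {e\<in>E. v \<in> e}"
    then have e: "e \<in> E" "v \<in> e" by auto
    obtain x y where "e = {x, y}" using card2[OF e(1)] by (meson card_2_iff)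
    then show "e \<in> (\<lambda>u. {u, v}) ` ?N" using e by (auto simp: neighborhood_def insert_commute)
  qed (auto simp: neighborhood_def)
  have inj: "inj_on (\<lambda>u. {u, v}) ?N" by (auto simp: inj_on_def doubleton_eq_iff)
  have vN: "v \<notin> ?N" and finN: "finite ?N" using neighborhood_subset[OF assms] by auto
  have "conflict E w C = sum ?f {e\<in>E. v \<notin> e} + sum ?f {e\<in>E. v \<in> e}"
    unfolding conflict_def
    by (subst sum.union_disjoint[symmetric]) (use finE in \<open>auto intro!: sum.cong\<close>)
  also have "sum ?f {e\<in>E. v \<in> e} = (\<Sum>u\<in>?N. if C u = C v then w v * w u else 0)"
    unfolding img sum.reindex[OF inj] o_def
  proof (rule sum.cong)
    fix u assume "u \<in> ?N"
    then have "u \<noteq> v" using vN by blast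
    then show "?f {u, v} = (if C u = C v then w v * w u else 0)" by (auto simp: mult.commute)
  qed simp
  also have "\<dots> = w v * sum w (same_neighbors E C v)"
    by (auto simp: same_neighbors_def sum_distrib_left sum.inter_filter[OF finN] intro!: sum.cong)
  finally show ?thesis .
qed

lemma same_neighbors_switch:
  assumes "v \<notin> neighborhood E v"
  shows "same_neighbors E (switch {v} C) v = opposite_neighbors E C v"
proof -
  have "other_color x = y \<longleftrightarrow> x \<noteq> y" "y = other_color x \<longleftrightarrow> x \<noteq> y" for x y
    by (cases x; cases y; simp)+
  then show ?thesis
    using assms by (auto simp: same_neighbors_def opposite_neighbors_def switch_def)
qed

lemma conflict_decreases:
  assumes G: "simple_graph V E" and "\<And>u. u \<in> V \<Longrightarrow> 0 < w u" and "0 < lam"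
    and "neighborhood E v \<noteq> {}" and sw: "switchable V E w lam C v"
  shows "conflict E w (switch {v} C) < conflict E w C"
proof -
  note N = neighborhood_subset[OF G, of v]
  have "0 < sum w (neighborhood E v)"
    using N assms by (intro sum_pos) auto
  then have "sum w (opposite_neighbors E C v) < sum w (same_neighbors E C v)"
    using sw \<open>0 < lam\<close> mult_pos_pos[of lam "sum w (neighborhood E v)"]
    unfolding switchable_def by linarith
  moreover have "0 < w v" using assms sw by (auto simp: switchable_def)
  moreover have "(\<Sum>e\<in>{e\<in>E. v \<notin> e}. if \<exists>c. \<forall>u\<in>e. switch {v} C u = c then prod w e else 0)
      = (\<Sum>e\<in>{e\<in>E. v \<notin> e}. if \<exists>c. \<forall>u\<in>e. C u = c then prod w e else 0)"
    by (intro sum.cong refl if_cong ex_cong1 ball_cong) (auto simp: switch_def)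
  ultimately show ?thesis
    unfolding conflict_split[OF G, where v = v] same_neighbors_switch[OF N(3)] by simp
qed

text \<open>Colourings are total functions, so only those agreeing with \<open>C0\<close> off
  \<open>V\<close> are counted; such a colouring is determined by its black vertices in
  \<open>V\<close>.\<close>

lemma finite_colorings_on:
  fixes V :: "'a set" and C0 :: "'a \<Rightarrow> color"
  assumes "finite V"
  shows "finite {C. \<forall>x. x \<notin> V \<longrightarrow> C x = C0 x}"
    "card {C. \<forall>x. x \<notin> V \<longrightarrow> C x = C0 x} \<le> 2 ^ card V"
proof -
  let ?K = "{C. \<forall>x. x \<notin> V \<longrightarrow> C x = C0 x}"
  let ?f = "\<lambda>C. {v\<in>V. C v = Black}"
  have inj: "inj_on ?f ?K"
  proof (rule inj_onI, rule ext)
    fix C D x assume "C \<in> ?K" "D \<in> ?K" "?f C = ?f D"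
    then have "x \<in> V \<Longrightarrow> C x = Black \<longleftrightarrow> D x = Black" "x \<notin> V \<Longrightarrow> C x = D x" by auto
    then show "C x = D x" by (metis color.exhaust)
  qed
  have sub: "?f ` ?K \<subseteq> Pow V" by auto
  show "finite ?K" using inj sub assms by (meson finite_Pow_iff finite_subset finite_imageD)
  show "card ?K \<le> 2 ^ card V" using card_inj_on_le[OF inj sub] assms by (simp add: card_Pow)
qed

lemma minority_run_Cons:
  assumes "minority_run M V E w lam (switch A C) T S" "admissible M A"
    "A \<subseteq> {v. switchable V E w lam C v}"
  shows "minority_run M V E w lam C (Suc T) (case_nat C S)"
  unfolding minority_run_def
proof (intro conjI allI impI)
  fix i assume "i < Suc T"
  then show "\<exists>A. admissible M A \<and> A \<subseteq> {v. switchable V E w lam (case_nat C S i) v} \<and>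
      case_nat C S (Suc i) = switch A (case_nat C S i)"
    using assms unfolding minority_run_def by (cases i) auto
qed simp

text \<open>Each switch strictly shrinks the set of colourings of lower conflict, so the size of
  this set bounds the run length. A vertex without neighbours would be switchable in every
  colouring, hence the last assumption.\<close>

lemma stable_run_exists:
  assumes G: "simple_graph V E" and "\<And>u. u \<in> V \<Longrightarrow> 0 < w u" and "0 < lam"
    and "\<And>v. v \<in> V \<Longrightarrow> neighborhood E v \<noteq> {}"
  shows "\<exists>T S. minority_run SB V E w lam C T S \<and> stable V E w lam (S T) \<and> T \<le> 2 ^ card V"
proof -
  define K where "K = {D. \<forall>x. x \<notin> V \<longrightarrow> D x = C x}"
  let ?below = "\<lambda>D. {D'\<in>K. conflict E w D' < conflict E w D}"
  have finV: "finite V" using G by (simp add: simple_graph_def)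
  note K = finite_colorings_on[OF finV, of C, folded K_def]
  have run: "D \<in> K \<Longrightarrow> \<exists>T S. minority_run SB V E w lam D T S \<and> stable V E w lam (S T) \<and> T \<le> card (?below D)"
    for D
  proof (induction "card (?below D)" arbitrary: D rule: less_induct)
    case less
    show ?case
    proof (cases "stable V E w lam D")
      case True
      then show ?thesis
        by (intro exI[of _ 0] exI[of _ "\<lambda>_. D"]) (simp add: minority_run_def)
    next
      case False
      then obtain v where v: "v \<in> V" "switchable V E w lam D v" by (auto simp: stable_def)
      let ?D = "switch {v} D"
      have D: "?D \<in> K" using less.prems v by (auto simp: K_def switch_def)
      have dec: "conflict E w ?D < conflict E w D"
        using conflict_decreases[OF G] assms v by blast
      have "?below ?D \<subset> ?below D" using dec D by auto
      then have lt: "card (?below ?D) < card (?below D)"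
        using K(1) by (intro psubset_card_mono) auto
      obtain T S where TS: "minority_run SB V E w lam ?D T S" "stable V E w lam (S T)"
          "T \<le> card (?below ?D)"
        using less.hyps[OF lt D] by blast
      have "minority_run SB V E w lam D (Suc T) (case_nat D S)"
        using TS(1) v by (intro minority_run_Cons) (auto simp: is_singleton_def)
      moreover have "stable V E w lam (case_nat D S (Suc T))" using TS(2) by simp
      moreover have "Suc T \<le> card (?below D)" using TS(3) lt by linarith
      ultimately show ?thesis by blast
    qed
  qed
  have "C \<in> K" by (simp add: K_def)
  then obtain T S where "minority_run SB V E w lam C T S" "stable V E w lam (S T)" "T \<le> card (?below C)"
    using run by blast
  moreover have "card (?below C) \<le> card K" using K(1) by (intro card_mono) auto
  ultimately show ?thesis using K(2) by (meson order_trans)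
qed

text \<open>Singletons are nonempty, so sequential runs are concurrent runs: a lower bound for
  \<open>CB\<close> and a terminating run for \<open>SB\<close> serve both models.\<close>

lemma stabilization_time_bounds:
  assumes G: "simple_graph V E" and "\<And>u. u \<in> V \<Longrightarrow> 0 < w u" and "0 < lam"
    and "\<And>v. v \<in> V \<Longrightarrow> neighborhood E v \<noteq> {}"
    and lower: "\<And>T S. minority_run CB V E w lam C T S \<Longrightarrow> stable V E w lam (S T) \<Longrightarrow> b \<le> real T"
  shows "\<exists>T. stabilization_time M V E w lam C = enat T \<and> b \<le> real T \<and> T \<le> 2 ^ card V"
proof -
  let ?X = "{enat T | T. \<exists>S. minority_run M V E w lam C T S \<and> stable V E w lam (S T)}"
  have CB: "minority_run CB V E w lam C T S" if "minority_run M' V E w lam C T S" for M' T S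
  proof (cases M')
    case SB
    have "admissible CB A" if "admissible SB A" for A :: "'a set"
      using that by (auto simp: is_singleton_def)
    then show ?thesis using that unfolding SB minority_run_def by meson
  qed (use that in simp)
  have SB: "minority_run M V E w lam C T S" if "minority_run SB V E w lam C T S" for T S
    using that CB by (cases M) auto
  obtain T0 S0 where 0: "minority_run SB V E w lam C T0 S0" "stable V E w lam (S0 T0)" "T0 \<le> 2 ^ card V"
    using stable_run_exists[where V = V and E = E and w = w and lam = lam and C = C] assms(1-4) by blast
  then have "enat T0 \<in> ?X" using SB by blast
  \<comment> \<open>The extended naturals are well-ordered, so the infimum is attained by an actual
    run.\<close>
  then have "Inf ?X \<in> ?X" and le: "Inf ?X \<le> enat T0" by (rule wellorder_InfI, rule Inf_lower)
  then obtain T S where T: "Inf ?X = enat T" "minority_run M V E w lam C T S" "stable V E w lam (S T)"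
    by auto
  show ?thesis
  proof (intro exI conjI)
    show "stabilization_time M V E w lam C = enat T" using T(1) by (simp add: stabilization_time_def)
    show "b \<le> real T" using lower[OF CB[OF T(2)] T(3)] .
    show "T \<le> 2 ^ card V" using le T(1) 0(3) by simp
  qed
qed

section \<open>Transport along an injective renaming of vertices\<close>

context
  fixes f :: "'a \<Rightarrow> 'b" and V :: "'a set" and E :: "'a set set" and w :: "'b \<Rightarrow> real"
  assumes inj: "inj f"
begin

lemma neighborhood_image: "neighborhood ((`) f ` E) (f v) = f ` neighborhood E v"
proof (rule set_eqI, rule iffI)
  fix u assume "u \<in> neighborhood ((`) f ` E) (f v)"
  then obtain e where e: "e \<in> E" "{u, f v} = f ` e" by (auto simp: neighborhood_def)
  then obtain u' where u: "u = f u'" by auto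
  then have "f ` {u', v} = f ` e" using e by simp
  then have "{u', v} = e" by (rule inj_image_eq_iff[OF inj, THEN iffD1])
  then show "u \<in> f ` neighborhood E v" using e u by (auto simp: neighborhood_def)
next
  fix u assume "u \<in> f ` neighborhood E v"
  then obtain u' where u: "u = f u'" "{u', v} \<in> E" by (auto simp: neighborhood_def)
  have "f ` {u', v} \<in> (`) f ` E" using u(2) by (rule imageI)
  then show "u \<in> neighborhood ((`) f ` E) (f v)" using u(1) by (simp add: neighborhood_def)
qed

lemma switchable_image:
  "switchable (f ` V) ((`) f ` E) w lam C (f v) \<longleftrightarrow> switchable V E (w \<circ> f) lam (C \<circ> f) v"
proof -
  have injon: "inj_on f A" for A using inj by (rule inj_on_subset) simp
  have same: "same_neighbors ((`) f ` E) C (f v) = f ` same_neighbors E (C \<circ> f) v"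
    by (auto simp: same_neighbors_def neighborhood_image)
  have opp: "opposite_neighbors ((`) f ` E) C (f v) = f ` opposite_neighbors E (C \<circ> f) v"
    unfolding opposite_neighbors_def same neighborhood_image using inj by (simp add: image_set_diff)
  show ?thesis
    unfolding switchable_def same opp neighborhood_image sum.reindex[OF injon]
    using inj by (simp add: inj_image_mem_iff)
qed

lemma minority_run_image:
  assumes "minority_run CB (f ` V) ((`) f ` E) w lam C T S"
  shows "minority_run CB V E (w \<circ> f) lam (C \<circ> f) T (\<lambda>i. S i \<circ> f)"
  unfolding minority_run_def
proof (intro conjI allI impI)
  show "S 0 \<circ> f = C \<circ> f" using assms by (simp add: minority_run_def)
  fix i assume "i < T"
  then obtain A where A: "A \<noteq> {}" "A \<subseteq> {v. switchable (f ` V) ((`) f ` E) w lam (S i) v}"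
      "S (Suc i) = switch A (S i)"
    using assms unfolding minority_run_def admissible.simps by blast
  have "A \<subseteq> f ` V" using A(2) by (auto simp: switchable_def)
  then have "f -` A \<noteq> {}" using A(1) by auto
  moreover have "f -` A \<subseteq> {v. switchable V E (w \<circ> f) lam (S i \<circ> f) v}"
    using A(2) switchable_image by auto
  moreover have "S (Suc i) \<circ> f = switch (f -` A) (S i \<circ> f)"
    using A(3) by (auto simp: switch_def)
  ultimately show "\<exists>A. admissible CB A \<and> A \<subseteq> {v. switchable V E (w \<circ> f) lam (S i \<circ> f) v} \<and>
      S (Suc i) \<circ> f = switch A (S i \<circ> f)"
    by (intro exI[of _ "f -` A"]) simp
qed

lemma stable_image:
  "stable (f ` V) ((`) f ` E) w lam C \<longleftrightarrow> stable V E (w \<circ> f) lam (C \<circ> f)"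
  by (simp add: stable_def switchable_image)

lemma simple_graph_image: "simple_graph V E \<Longrightarrow> simple_graph (f ` V) ((`) f ` E)"
  using inj by (auto simp: simple_graph_def nsets_def card_image inj_on_subset)

end

section \<open>Switch counts in one ring\<close>

locale ring_phase =
  fixes p :: nat
  assumes p_ge_3: "3 \<le> p"
begin

text \<open>Gate \<open>k\<close> of a ring skips exactly the phases \<open>i\<close> with \<open>(i + k) mod p \<in> {0, 1}\<close>, so
  \<open>gate_count k t\<close> is its number of switches when the output has switched \<open>t\<close> times. The negative
  initial values \<open>- skips k\<close> record the tokens that a ring holds at the start.\<close>

definition skips :: "int \<Rightarrow> int" where
  "skips x = 2 * (x div int p) + min 2 (x mod int p)"

definition gate_count :: "nat \<Rightarrow> int \<Rightarrow> int" where
  "gate_count k t = t - skips (t + int k)"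

section \<open>Arithmetic of phases around the ring\<close>

lemma p_pos: "0 < p"
  using p_ge_3 by simp

lemma phase_nonneg: "0 \<le> x mod int p" and phase_less: "x mod int p < int p"
  using p_pos by simp_all

lemma skips_Suc: "skips (x + 1) = skips x + (if x mod int p < 2 then 1 else 0)"
proof -
  define q r where "q = x div int p" and "r = x mod int p"
  have x: "x = int p * q + r" by (simp add: q_def r_def)
  have r: "0 \<le> r" "r < int p" using p_ge_3 by (simp_all add: r_def)
  show ?thesis
  proof (cases "r + 1 < int p")
    case True
    have "(x + 1) div int p = q" "(x + 1) mod int p = r + 1"
      using True r p_ge_3 by (simp_all add: x add.assoc)
    then show ?thesis using r by (simp add: skips_def flip: q_def r_def)
  next
    case False
    then have *: "x + 1 = int p * (q + 1)" using r by (simp add: x algebra_simps)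
    have "(x + 1) div int p = q + 1" "(x + 1) mod int p = 0"
      unfolding * using p_ge_3 by simp_all
    then show ?thesis using r False p_ge_3 by (simp add: skips_def flip: q_def r_def)
  qed
qed

text \<open>A full turn contributes the even amount 2, so the total is odd only between the two
  skips of a turn.\<close>

lemma odd_skips_iff: "odd (skips x) \<longleftrightarrow> x mod int p = 1"
proof -
  have "x mod int p = 0 \<or> x mod int p = 1 \<or> 2 \<le> x mod int p"
    using phase_nonneg[of x] by linarith
  then show ?thesis by (auto simp: skips_def)
qed

lemma skips_period: "skips (x + int p) = skips x + 2"
  using p_ge_3 by (simp add: skips_def)

lemma gate_count_Suc_time:
  "gate_count k (t + 1) = gate_count k t + (if (t + int k) mod int p < 2 then 0 else 1)"
  using skips_Suc[of "t + int k"] by (simp add: gate_count_def add.commute add.left_commute)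

lemma gate_count_Suc_index:
  "gate_count (Suc k) t = gate_count k t - (if (t + int k) mod int p < 2 then 1 else 0)"
  using skips_Suc[of "t + int k"] by (simp add: gate_count_def add.commute add.left_commute)

text \<open>Below, gate \<open>k\<close> is said to be at residue
  \<open>(t + int k) mod int p\<close>. At residue 1, between its two skips, a gate has the parity
  that a gate at residue 2 or more reaches only by switching. To the output it already looks
  finished, so only the gate at residue 0 must be missing.\<close>

lemma even_gate_count_iff: "even (gate_count k t - t) \<longleftrightarrow> (t + int k) mod int p \<noteq> 1"
  using odd_skips_iff[of "t + int k"] by (auto simp: gate_count_def)

lemma last_phase:
  shows "(t + int (p - 1)) mod int p = (if t mod int p = 0 then int p - 1 else t mod int p - 1)"
proof -
  have "(t + int (p - 1)) mod int p = (t mod int p + (int p - 1)) mod int p"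
    using p_ge_3 by (simp add: mod_add_left_eq of_nat_diff)
  also have "\<dots> = (if t mod int p = 0 then int p - 1 else t mod int p - 1)"
  proof (cases "t mod int p = 0")
    case True
    moreover have "(int p - 1) mod int p = int p - 1"
      using p_ge_3 by (intro mod_pos_pos_trivial) auto
    ultimately show ?thesis by simp
  next
    case False
    have "t mod int p + (int p - 1) = (t mod int p - 1) + int p" by simp
    then have "(t mod int p + (int p - 1)) mod int p = (t mod int p - 1) mod int p"
      by (metis mod_add_self2)
    also have "\<dots> = t mod int p - 1"
      using False phase_nonneg[of t] phase_less[of t]
      by (intro mod_pos_pos_trivial) linarith+
    finally show ?thesis using False by simp
  qed
  finally show ?thesis .
qed

lemma last_skips_iff: "(t + int (p - 1)) mod int p < 2 \<longleftrightarrow> t mod int p \<in> {1, 2}"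
proof -
  have "(if y = 0 then int p - 1 else y - 1) < 2 \<longleftrightarrow> y \<in> {1, 2}" if "0 \<le> y" for y
    using that p_ge_3 by auto
  then show ?thesis unfolding last_phase[of t] using phase_nonneg[of t] by blast
qed

text \<open>One turn raises the argument of \<open>skips\<close> by \<open>p\<close> and its value
  by 2, so the last gate lags two behind the first, or only one while the last gate itself is
  skipping.\<close>

lemma gate_count_wrap:
  "gate_count (p - 1) t = gate_count 0 t - (if t mod int p \<in> {1, 2} then 1 else 2)"
proof -
  have "t + int (p - 1) + 1 = t + int p" using p_ge_3 by simp
  then show ?thesis
    using skips_Suc[of "t + int (p - 1)"] skips_period[of t] last_skips_iff[of t]
    by (simp add: gate_count_def split: if_splits)
qed

lemma phase_inj:
  assumes "(t + int j) mod int p = (t + int k) mod int p" "j < p" "k < p"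
  shows "j = k"
proof -
  have "int j mod int p = int k mod int p"
    using assms(1) by (metis add_diff_cancel_left' mod_diff_left_eq)
  then show ?thesis using assms by simp
qed

lemma phase_surj:
  assumes "0 \<le> y" "y < int p"
  obtains k where "k < p" "(t + int k) mod int p = y"
proof -
  define k where "k = nat ((y - t) mod int p)"
  have k: "int k = (y - t) mod int p" using p_ge_3 by (simp add: k_def)
  have "k < p" using k p_ge_3 by (metis of_nat_0_less_iff of_nat_less_iff pos_mod_bound
        gr0I not_numeral_le_zero)
  moreover have "(t + int k) mod int p = y"
    unfolding k using assms by (simp add: mod_add_right_eq)
  ultimately show ?thesis by (rule that)
qed

text \<open>The arguments are the switch counts of one ring: gates \<open>n\<close>, relays \<open>r\<close>, echoes \<open>e\<close>, output \<open>t\<close>,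
  input \<open>u\<close> (the output of the ring above), copy \<open>m\<close>, acknowledgement \<open>s\<close> to the ring above and
  acknowledgement \<open>d\<close> from the ring below. All \<open>_ready\<close> predicates depend on parities only, i.e. on
  colours.\<close>

definition level_inv :: "(nat \<Rightarrow> int) \<Rightarrow> (nat \<Rightarrow> int) \<Rightarrow> (nat \<Rightarrow> int) \<Rightarrow>
    int \<Rightarrow> int \<Rightarrow> int \<Rightarrow> int \<Rightarrow> int \<Rightarrow> bool" where
  "level_inv n r e t u m s d \<longleftrightarrow>
     (\<forall>k<p. gate_count k t \<le> e k \<and> e k \<le> r k \<and> r k \<le> n k \<and> n k \<le> gate_count k (t + 1)) \<and>
     (\<forall>k. Suc k < p \<longrightarrow> n k - 1 \<le> e (Suc k) \<and> n (Suc k) \<le> r k) \<and>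
     u - 1 \<le> s \<and> s \<le> m \<and> m \<le> e 0 \<and> n 0 \<le> u \<and>
     s \<le> gate_count 0 t \<and>
     (t mod int p \<in> {1, 2} \<longrightarrow> s = gate_count 0 t) \<and>
     (gate_count (p - 1) t < n (p - 1) \<longrightarrow> s = gate_count 0 t) \<and>
     (\<forall>k<p. gate_count k t < n k \<longrightarrow> d = t)"

definition out_ready :: "(nat \<Rightarrow> int) \<Rightarrow> int \<Rightarrow> bool" where
  "out_ready e t \<longleftrightarrow> (\<forall>j<p. \<forall>k<p. even (e j - t) \<longrightarrow> even (e k - t) \<longrightarrow> j = k)"

text \<open>\<open>m \<noteq> s\<close> is a parity test as well, since the invariant leaves only
  \<open>m = s\<close> and \<open>m = s + 1\<close>.\<close>

definition ack_ready :: "int \<Rightarrow> int \<Rightarrow> int \<Rightarrow> bool" where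
  "ack_ready m s t \<longleftrightarrow> m \<noteq> s \<and> odd (t - s)"

definition gate_ready :: "(nat \<Rightarrow> int) \<Rightarrow> (nat \<Rightarrow> int) \<Rightarrow> (nat \<Rightarrow> int) \<Rightarrow>
    int \<Rightarrow> int \<Rightarrow> int \<Rightarrow> nat \<Rightarrow> bool" where
  "gate_ready n r e u s d k \<longleftrightarrow>
     odd ((if k = 0 then u else r (k - 1)) - n k) \<and>
     even ((if Suc k = p then s else e (Suc k)) - n k) \<and>
     even (d - n k)"

section \<open>Consequences of the ring invariant and its preservation\<close>

context
  fixes n r e :: "nat \<Rightarrow> int" and t u m s d :: int
  assumes inv: "level_inv n r e t u m s d"
begin

lemma inv_chain:
  assumes "k < p"
  shows "gate_count k t \<le> e k" "e k \<le> r k" "r k \<le> n k" "n k \<le> gate_count k (t + 1)"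
    "n k \<le> gate_count k t + 1" "n k \<le> e k + 1"
  using inv assms gate_count_Suc_time[of k t] unfolding level_inv_def by (fastforce split: if_splits)+

lemma inv_link:
  assumes "Suc k < p"
  shows "n k - 1 \<le> e (Suc k)" "n (Suc k) \<le> r k"
  using inv assms unfolding level_inv_def by blast+

lemma inv_ends: "u - 1 \<le> s" "s \<le> m" "m \<le> e 0" "n 0 \<le> u" "s \<le> gate_count 0 t"
    "gate_count 0 t - 1 \<le> s" "e 0 \<le> u" "m \<le> s + 1"
  using inv inv_chain[of 0] p_ge_3 unfolding level_inv_def by force+

lemma inv_s_skip: "t mod int p \<in> {1, 2} \<Longrightarrow> s = gate_count 0 t"
  using inv unfolding level_inv_def by blast

lemma inv_s_last: "gate_count (p - 1) t < n (p - 1) \<Longrightarrow> s = gate_count 0 t"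
  using inv unfolding level_inv_def by blast

lemma inv_ack: "k < p \<Longrightarrow> gate_count k t < n k \<Longrightarrow> d = t"
  using inv unfolding level_inv_def by blast

lemma input_bounds:
  assumes "k < p"
  shows "n k \<le> (if k = 0 then u else r (k - 1))" "(if k = 0 then u else r (k - 1)) \<le> e k + 1"
proof -
  show "n k \<le> (if k = 0 then u else r (k - 1))"
    using inv_ends inv_link[of "k - 1"] assms by (cases k) auto
  show "(if k = 0 then u else r (k - 1)) \<le> e k + 1"
    using inv_ends inv_link[of "k - 1"] inv_chain(3)[of "k - 1"] assms by (cases k) auto
qed

text \<open>An active input forces the gate's own follower chain to be settled, so that the two
  acknowledgements decide.\<close>

lemma odd_inputD:
  assumes "k < p" "odd ((if k = 0 then u else r (k - 1)) - n k)"
  shows "(if k = 0 then u else r (k - 1)) = n k + 1" "e k = n k" "r k = n k"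
proof -
  let ?i = "if k = 0 then u else r (k - 1)"
  have "?i \<noteq> n k" using assms(2) by (auto split: if_splits)
  then show "?i = n k + 1" "e k = n k" "r k = n k"
    using input_bounds[OF assms(1)] inv_chain[OF assms(1)] by linarith+
qed

text \<open>Readiness shows only parities, but the invariant leaves so few values for each count
  that no wrong one passes. So a ready gate has not yet switched in this phase, is not due to skip,
  and both acknowledgements are up to date.\<close>

lemma gate_readyD:
  assumes k: "k < p" and d: "t - 1 \<le> d" "d \<le> t" and ready: "gate_ready n r e u s d k"
  shows "n k = gate_count k t" "gate_count k (t + 1) = gate_count k t + 1" "d = t"
    "2 \<le> (t + int k) mod int p"
    "Suc k < p \<Longrightarrow> e (Suc k) = n k"
    "Suc k = p \<Longrightarrow> s = gate_count 0 t"
    "(if k = 0 then u else r (k - 1)) = n k + 1" "e k = n k" "r k = n k"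
proof -
  let ?ph = "(t + int k) mod int p"
  have ph0: "0 \<le> ?ph" using p_ge_3 by simp
  show set: "(if k = 0 then u else r (k - 1)) = n k + 1" "e k = n k" "r k = n k"
    using odd_inputD[OF k] ready unfolding gate_ready_def by blast+
  have tip: "even ((if Suc k = p then s else e (Suc k)) - n k)" and dn: "even (d - n k)"
    using ready unfolding gate_ready_def by auto
  show link: "e (Suc k) = n k" if "Suc k < p"
  proof -
    have "e (Suc k) \<noteq> n k - 1" using tip that by auto
    moreover have "e (Suc k) \<le> n k"
      using inv_chain[of "Suc k"] inv_link(2)[OF that] inv_chain(3)[OF k] that by linarith
    ultimately show ?thesis using inv_link(1)[OF that] by linarith
  qed
  \<comment> \<open>If a skipping gate agrees with the next echo, the next gate has already switched
    in this phase. Then \<open>d = t\<close>, which by parity leaves residue 0; but then the next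
    gate is at residue 1 and cannot have switched. For the last gate, \<open>s\<close> has the wrong
    parity.\<close>
  have not_skip: "\<not> (n k = gate_count k t \<and> ?ph < 2)"
  proof
    assume a: "n k = gate_count k t \<and> ?ph < 2"
    show False
    proof (cases "Suc k < p")
      case True
      have g: "gate_count (Suc k) t = gate_count k t - 1"
        using gate_count_Suc_index[of k t] a by simp
      have e: "gate_count (Suc k) t < n (Suc k)"
        using link[OF True] a g inv_chain(2,3)[of "Suc k"] True by linarith
      have "d = t" using inv_ack[OF True e] .
      then have "?ph \<noteq> 1" using dn a even_gate_count_iff[of k t] by auto
      then have "?ph = 0" using a ph0 by linarith
      then have "(t + int (Suc k)) mod int p = 1"
        using p_ge_3 mod_add_left_eq[of "t + int k" "int p" 1] by (simp add: ac_simps)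
      then have "gate_count (Suc k) (t + 1) = gate_count (Suc k) t"
        using gate_count_Suc_time[of "Suc k" t] by simp
      then show False using e inv_chain(4)[OF True] by linarith
    next
      case False
      then have kp: "k = p - 1" "Suc k = p" using k by auto
      then have "t mod int p \<in> {1, 2}" using last_skips_iff[of t] a by simp
      then have "s = n k + 1" using inv_s_skip gate_count_wrap[of t] a kp by simp
      then show False using tip kp by simp
    qed
  qed
  \<comment> \<open>A gate that has switched in this phase has \<open>d = t\<close>, so the test on
    \<open>d\<close> would require residue 1, where no switch is possible.\<close>
  show fresh: "n k = gate_count k t"
  proof (rule ccontr)
    assume "n k \<noteq> gate_count k t"
    then have n: "n k = gate_count k t + 1" using inv_chain[OF k] by linarith
    then have "d = t" using inv_ack[OF k] by simp
    then have "odd (gate_count k t - t)" using dn n by auto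
    then have "?ph < 2" using even_gate_count_iff[of k t] by auto
    then show False using n inv_chain(4)[OF k] gate_count_Suc_time[of k t] by simp
  qed
  show ph: "2 \<le> ?ph" using not_skip fresh by linarith
  then show "gate_count k (t + 1) = gate_count k t + 1"
    using gate_count_Suc_time[of k t] by simp
  have "even (n k - t)" using ph fresh even_gate_count_iff[of k t] by auto
  then have "d \<noteq> t - 1" using dn by auto
  then show "d = t" using d by linarith
  show "s = gate_count 0 t" if "Suc k = p"
  proof -
    have kp: "k = p - 1" using that by simp
    then have "gate_count k t = gate_count 0 t - 2"
      using ph gate_count_wrap[of t] last_skips_iff[of t] by auto
    then have "s \<noteq> gate_count 0 t - 1" using tip fresh that by auto
    then show ?thesis using inv_ends by linarith
  qed
qed

text \<open>The echo of the gate at residue 0 always disagrees with the output and uses up the one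
  tolerated disagreement. Hence every gate due in this phase has switched, together with its relay
  and echo.\<close>

lemma out_readyD:
  assumes "out_ready e t"
  shows "k < p \<Longrightarrow> e k = gate_count k (t + 1)" "k < p \<Longrightarrow> r k = gate_count k (t + 1)"
    "k < p \<Longrightarrow> n k = gate_count k (t + 1)" "d = t" "s = gate_count 0 t"
proof -
  obtain k0 where k0: "k0 < p" "(t + int k0) mod int p = 0"
    using phase_surj[of 0 t] p_ge_3 by auto
  have "e k0 = gate_count k0 t"
    using inv_chain[OF k0(1)] gate_count_Suc_time[of k0 t] k0 by simp
  then have ev0: "even (e k0 - t)" using even_gate_count_iff[of k0 t] k0 by simp
  have e: "e k = gate_count k (t + 1)" if k: "k < p" for k
  proof (cases "(t + int k) mod int p < 2")
    case True
    then show ?thesis using inv_chain[OF k] gate_count_Suc_time[of k t] by simp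
  next
    case False
    then have "k \<noteq> k0" using k0 by auto
    then have "odd (e k - t)" using assms ev0 k k0 unfolding out_ready_def by blast
    moreover have "even (gate_count k t - t)" using False even_gate_count_iff[of k t] by auto
    ultimately have "e k \<noteq> gate_count k t" by auto
    then show ?thesis using inv_chain[OF k] gate_count_Suc_time[of k t] False by simp
  qed
  have n: "n k = gate_count k (t + 1)" "r k = gate_count k (t + 1)" if "k < p" for k
    using e[OF that] inv_chain[OF that] by linarith+
  show "k < p \<Longrightarrow> e k = gate_count k (t + 1)" "k < p \<Longrightarrow> r k = gate_count k (t + 1)"
    "k < p \<Longrightarrow> n k = gate_count k (t + 1)" using e n by auto
  obtain k2 where k2: "k2 < p" "(t + int k2) mod int p = 2"
    using phase_surj[of 2 t] p_ge_3 by auto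
  then show "d = t" using inv_ack[OF k2(1)] n(1)[OF k2(1)] gate_count_Suc_time[of k2 t] by simp
  show "s = gate_count 0 t"
  proof (cases "t mod int p \<in> {1, 2}")
    case True
    then show ?thesis by (rule inv_s_skip)
  next
    case False
    then have "\<not> (t + int (p - 1)) mod int p < 2" using last_skips_iff by blast
    then have "gate_count (p - 1) t < n (p - 1)"
      using n(1)[of "p - 1"] gate_count_Suc_time[of "p - 1" t] p_ge_3 by simp
    then show ?thesis by (rule inv_s_last)
  qed
qed

text \<open>If \<open>s\<close> had already reached \<open>gate_count 0 t\<close>, then
  \<open>m = s + 1\<close> would mean that gate 0 switched in this phase. It was then not skipping,
  so \<open>s\<close> has the parity of \<open>t\<close> and the output blocks the
  acknowledgement.\<close>

lemma ack_readyD: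
  assumes "ack_ready m s t"
  shows "m = s + 1" "s < gate_count 0 t"
proof -
  show m: "m = s + 1" using assms inv_ends unfolding ack_ready_def by linarith
  show "s < gate_count 0 t"
  proof (rule ccontr)
    assume "\<not> s < gate_count 0 t"
    then have s: "s = gate_count 0 t" using inv_ends by linarith
    then have "gate_count 0 t < gate_count 0 (t + 1)"
      using m inv_ends inv_chain[of 0, OF p_pos] by linarith
    then have "\<not> t mod int p < 2" using gate_count_Suc_time[of 0 t] by (auto split: if_splits)
    then have "even (s - t)" using s even_gate_count_iff[of 0 t] by auto
    then show False using assms unfolding ack_ready_def by auto
  qed
qed

text \<open>Every change is judged in the old state and may be absent, so arbitrary simultaneous
  switches are covered. The adjacent rings enter only through \<open>u\<close> and
  \<open>d\<close>.\<close>

lemma level_inv_step: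
  fixes n' r' e' :: "nat \<Rightarrow> int" and t' u' m' s' d' :: int
  assumes d: "t - 1 \<le> d" "d \<le> t" and d': "d \<le> d'" "d' \<le> t'"
    and n': "\<And>k. k < p \<Longrightarrow> n' k = n k \<or> n' k = n k + 1 \<and> gate_ready n r e u s d k"
    and r': "\<And>k. k < p \<Longrightarrow> r' k = r k \<or> r' k = r k + 1 \<and> r k \<noteq> n k"
    and e': "\<And>k. k < p \<Longrightarrow> e' k = e k \<or> e' k = e k + 1 \<and> e k \<noteq> r k"
    and m': "m' = m \<or> m' = m + 1 \<and> m \<noteq> e 0"
    and s': "s' = s \<or> s' = s + 1 \<and> ack_ready m s t"
    and t': "t' = t \<or> t' = t + 1 \<and> out_ready e t"
    and u': "u' = u \<or> u' = u + 1 \<and> s = u"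
  shows "level_inv n' r' e' t' u' m' s' d'"
proof -
  have gready: "k < p \<Longrightarrow> n' k \<noteq> n k \<Longrightarrow> gate_ready n r e u s d k" for k using n' by auto
  have nD: "n' k = n k + 1" "n k = gate_count k t" "gate_count k (t + 1) = gate_count k t + 1" "d = t"
      "Suc k < p \<Longrightarrow> e (Suc k) = n k" "Suc k = p \<Longrightarrow> s = gate_count 0 t"
      "(if k = 0 then u else r (k - 1)) = n k + 1" "e k = n k"
    if "k < p" "n' k \<noteq> n k" for k
    using n'[OF that(1)] gate_readyD[OF that(1) d gready[OF that]] that by auto
  have mono: "k < p \<Longrightarrow> n k \<le> n' k" "k < p \<Longrightarrow> r k \<le> r' k" "k < p \<Longrightarrow> e k \<le> e' k" for k
    using n' r' e' by fastforce+
  have rb: "r' k \<le> n k" if "k < p" for k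
    using r'[OF that] inv_chain[OF that] by linarith
  have eb: "e' k \<le> r k" if "k < p" for k
    using e'[OF that] inv_chain[OF that] by linarith
  have mb: "m \<le> m'" "m' \<le> e 0" using m' inv_ends by linarith+
  have sb: "s \<le> s'" "s' \<le> m" "s' \<le> gate_count 0 t"
    using s' inv_ends ack_readyD by linarith+
  note p0 = p_pos
  have p1: "p - 1 < p" "Suc (p - 1) = p" using p_ge_3 by auto
  have links: "n' k - 1 \<le> e' (Suc k) \<and> n' (Suc k) \<le> r' k" if k: "Suc k < p" for k
  proof
    have "k < p" using k by simp
    show "n' k - 1 \<le> e' (Suc k)"
      using inv_link(1)[OF k] nD(1,5)[OF \<open>k < p\<close>] k mono(3)[OF k] by (cases "n' k = n k") auto
    show "n' (Suc k) \<le> r' k"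
      using inv_link(2)[OF k] nD(1,7)[OF k] mono(2)[OF \<open>k < p\<close>] by (cases "n' (Suc k) = n (Suc k)") auto
  qed
  have n0: "n' 0 \<le> u'"
    using inv_ends u' nD(1,7)[OF p0] by (cases "n' 0 = n 0") auto
  have ends: "u' - 1 \<le> s' \<and> s' \<le> m' \<and> m' \<le> e' 0 \<and> n' 0 \<le> u'"
    using n0 u' sb mb mono(3)[OF p0] inv_ends by linarith
  show ?thesis
  proof (cases "t' = t")
    case True
    have chain: "gate_count k t \<le> e' k \<and> e' k \<le> r' k \<and> r' k \<le> n' k \<and> n' k \<le> gate_count k (t + 1)"
      if k: "k < p" for k
      using inv_chain[OF k] mono[OF k] rb[OF k] eb[OF k] nD[OF k] by (cases "n' k = n k") auto
    have skip: "s' = gate_count 0 t" if "t mod int p \<in> {1, 2}"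
      using inv_s_skip[OF that] sb by linarith
    have last: "s' = gate_count 0 t" if "gate_count (p - 1) t < n' (p - 1)"
      using that inv_s_last nD(6)[OF p1(1) _ p1(2)] sb by (cases "n' (p - 1) = n (p - 1)") auto
    have ack: "d' = t" if "k < p" "gate_count k t < n' k" for k
      using that inv_ack[OF that(1)] nD(4)[OF that(1)] d' True by (cases "n' k = n k") auto
    show ?thesis unfolding level_inv_def True using chain links ends sb(3) skip last ack by blast
  next
    \<comment> \<open>The output moved, so all due gates had finished and none could be ready: their
      counts are the base values of the next phase.\<close>
    case False
    then have t: "t' = t + 1" "out_ready e t" using t' by auto
    note z = out_readyD[OF t(2)]
    have same: "n' k = gate_count k t' \<and> r' k = gate_count k t' \<and> e' k = gate_count k t'"
      if k: "k < p" for k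
    proof -
      have "n' k = n k" using nD(2,3)[OF k] z(3)[OF k] by force
      then show ?thesis using z(1-3)[OF k] r'[OF k] e'[OF k] t(1) by auto
    qed
    have s: "s' = gate_count 0 t" using z(5) sb by linarith
    have chain: "gate_count k t' \<le> e' k \<and> e' k \<le> r' k \<and> r' k \<le> n' k \<and> n' k \<le> gate_count k (t' + 1)"
      if k: "k < p" for k
      using same[OF k] gate_count_Suc_time[of k t'] by auto
    have "s' \<le> gate_count 0 t'" using s gate_count_Suc_time[of 0 t] t(1) by auto
    \<comment> \<open>Residue 1 or 2 in the new phase means 0 or 1 in the old one, so gate 0 was
      skipping and its target did not change.\<close>
    moreover have "s' = gate_count 0 t'" if "t' mod int p \<in> {1, 2}"
    proof -
      have "(t + int 0) mod int p < 2"
      proof (rule ccontr)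
        assume a: "\<not> ?thesis"
        have "(t + 1) mod int p = (t mod int p + 1) mod int p" by (simp add: mod_add_left_eq)
        then have "(t mod int p + 1) mod int p \<in> {1, 2}" using that t(1) by simp
        moreover have "t mod int p < int p" using p_ge_3 by simp
        ultimately show False using a
          by (cases "t mod int p + 1 = int p") auto
      qed
      then show ?thesis using s gate_count_Suc_time[of 0 t] t(1) by simp
    qed
    ultimately show ?thesis
      unfolding level_inv_def using chain links ends same p1(1) by auto
  qed
qed

text \<open>An unready output leaves some due gate unswitched. Its acknowledgements are in place, so
  it can only lack its input; this lack passes back from gate to gate down to gate 0, which
  therefore waits for \<open>u\<close>.\<close>

lemma stuck_level:
  assumes d: "d = t"
    and settled: "\<And>k. k < p \<Longrightarrow> r k = n k" "\<And>k. k < p \<Longrightarrow> e k = r k" "m = e 0"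
    and stuck: "\<And>k. k < p \<Longrightarrow> \<not> gate_ready n r e u s d k" "\<not> ack_ready m s t" "\<not> out_ready e t"
  shows "2 \<le> t mod int p \<and> u = gate_count 0 t \<and> s = u"
proof -
  note p0 = p_pos
  have s: "s = gate_count 0 t"
  proof (rule ccontr)
    assume a: "s \<noteq> gate_count 0 t"
    then have sm: "s = gate_count 0 t - 1" using inv_ends by linarith
    then have "m = gate_count 0 t"
      using inv_ends settled inv_chain[OF p0] by linarith
    moreover have "t mod int p \<noteq> 1" using inv_s_skip a by auto
    then have "even (gate_count 0 t - t)" using even_gate_count_iff[of 0 t] by simp
    ultimately show False using stuck(2) sm unfolding ack_ready_def by auto
  qed
  obtain k where k: "k < p" "\<not> (t + int k) mod int p < 2" "n k = gate_count k t"
  proof -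
    have "\<exists>k<p. \<not> (t + int k) mod int p < 2 \<and> n k = gate_count k t"
    proof (rule ccontr)
      assume a: "\<not> ?thesis"
      have "(t + int k) mod int p = 0" if "k < p" "even (e k - t)" for k
      proof (rule ccontr)
        assume b: "(t + int k) mod int p \<noteq> 0"
        show False
        proof (cases "(t + int k) mod int p < 2")
          case True
          then have "(t + int k) mod int p = 1"
            using b phase_nonneg[of "t + int k"] by linarith
          moreover have "e k = gate_count k t"
            using inv_chain[OF that(1)] gate_count_Suc_time[of k t] True by simp
          ultimately show False using that even_gate_count_iff[of k t] by simp
        next
          case False
          then have "n k = gate_count k t + 1" using a that(1) inv_chain[OF that(1)] by force
          then have "e k = gate_count k t + 1" using settled that(1) by simp
          then show False using that(2) False even_gate_count_iff[of k t] by auto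
        qed
      qed
      then have "out_ready e t" unfolding out_ready_def using phase_inj by metis
      then show False using stuck(3) by simp
    qed
    then show ?thesis using that by blast
  qed
  have down: "2 \<le> t mod int p \<and> u = gate_count 0 t"
    if "k < p" "\<not> (t + int k) mod int p < 2" "n k = gate_count k t" for k
    using that
  proof (induction k)
    case (Suc k)
    have kp: "k < p" using Suc.prems by simp
    have ev: "even (gate_count (Suc k) t - t)"
      using Suc.prems even_gate_count_iff[of "Suc k" t] by auto
    have tip: "even ((if Suc (Suc k) = p then s else e (Suc (Suc k))) - n (Suc k))"
    proof (cases "Suc (Suc k) = p")
      case True
      then have "Suc k = p - 1" by simp
      then show ?thesis using True s Suc.prems gate_count_wrap[of t] last_skips_iff[of t] by auto
    next
      case False
      then have l: "Suc (Suc k) < p" using Suc.prems by simp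
      have "e (Suc (Suc k)) \<le> n (Suc k)" using inv_link(2)[OF l] settled l Suc.prems by simp
      moreover have "gate_count (Suc (Suc k)) t = gate_count (Suc k) t"
        using gate_count_Suc_index[of "Suc k" t] Suc.prems by simp
      ultimately have "e (Suc (Suc k)) = n (Suc k)" using inv_chain[OF l] Suc.prems by linarith
      then show ?thesis using False by simp
    qed
    have "\<not> odd (r k - n (Suc k))"
      using stuck(1)[OF Suc.prems(1)] tip ev d Suc.prems unfolding gate_ready_def by auto
    then have "r k \<noteq> n (Suc k) + 1" by auto
    then have nk: "n k = n (Suc k)"
      using input_bounds[OF Suc.prems(1)] settled(1)[OF kp] settled(1,2)[OF Suc.prems(1)] by simp
    \<comment> \<open>A skipping gate \<open>k\<close> would have \<open>gate_count k t\<close> one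
      above \<open>gate_count (Suc k) t\<close>, against the lower bound on
      \<open>n k\<close>.\<close>
    have ph: "\<not> (t + int k) mod int p < 2"
      using nk Suc.prems inv_chain[OF kp] gate_count_Suc_index[of k t] by (auto split: if_splits)
    then have "gate_count (Suc k) t = gate_count k t" using gate_count_Suc_index[of k t] by simp
    then show ?case using Suc.IH[OF kp ph] nk Suc.prems by simp
  next
    case 0
    have ev: "even (gate_count 0 t - t)" using 0 even_gate_count_iff[of 0 t] by auto
    have l: "Suc 0 < p" using p_ge_3 by simp
    have "e (Suc 0) \<le> n 0" using inv_link(2)[OF l] settled l p0 by simp
    moreover have "gate_count (Suc 0) t = gate_count 0 t"
      using gate_count_Suc_index[of 0 t] 0 by simp
    ultimately have "e (Suc 0) = n 0" using inv_chain[OF l] 0 by linarith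
    then have "\<not> odd (u - n 0)" using stuck(1)[OF p0] ev d 0 l unfolding gate_ready_def by auto
    then have "u = n 0" using inv_ends settled p0 by (cases "u = n 0 + 1") auto
    then show ?case using 0 by simp
  qed
  show ?thesis using down[OF k] s by simp
qed

end

text \<open>At residue 2 or more both skips of the current turn are over, so the count is
  \<open>t - 2 * q - 2\<close> with \<open>q = t div int p\<close>. The second claim starts the
  growth at the top ring, whose input never moves.\<close>

lemma gate_count_growth:
  assumes "2 \<le> t mod int p"
  shows "int p * gate_count 0 t \<le> (int p - 2) * t" "gate_count 0 t = 0 \<Longrightarrow> 0 \<le> t \<Longrightarrow> 2 \<le> t"
proof -
  define q r where "q = t div int p" and "r = t mod int p"
  have t: "t = int p * q + r" by (simp add: q_def r_def)
  have r: "2 \<le> r" "r < int p" using assms p_ge_3 by (simp_all add: r_def)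
  have g: "gate_count 0 t = t - 2 * q - 2"
    using r by (simp add: gate_count_def skips_def flip: q_def r_def)
  show "int p * gate_count 0 t \<le> (int p - 2) * t"
    unfolding g using r by (simp add: t algebra_simps)
  assume "gate_count 0 t = 0" "0 \<le> t"
  moreover have "0 \<le> q"
    using \<open>0 \<le> t\<close> p_pos by (simp add: q_def pos_imp_zdiv_nonneg_iff)
  ultimately show "2 \<le> t" using g by linarith
qed

end

section \<open>The chain of rings as a graph\<close>

datatype node = Gate nat nat | Relay nat nat | Echo nat nat | Out nat | Copy nat | Ack nat

instance node :: countable
  by countable_datatype

text \<open>A chain \<open>Gate l k\<close>, \<open>Relay l k\<close>, \<open>Gate l (k + 1)\<close> of decreasing weights stores the tokens.
  \<open>Echo l (k + 1)\<close> and \<open>Ack l\<close> are so light in the neighbourhood of \<open>Gate l k\<close> that they only decide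
  when everything else is at the threshold; this is how light nodes hold back heavy ones.
  Level \<open>0\<close> is the fastest; the input of ring \<open>l\<close> is \<open>Out (l + 1)\<close>, its acknowledgement upwards is
  \<open>Ack (l + 1)\<close>, and \<open>Out L\<close> never switches.\<close>

fun arc :: "nat \<Rightarrow> node \<Rightarrow> node \<Rightarrow> bool" where
  "arc p (Gate l k) (Relay l' k') \<longleftrightarrow> l' = l \<and> (k' = k \<or> Suc k' = k)"
| "arc p (Gate l k) (Echo l' k') \<longleftrightarrow> l' = l \<and> k' = Suc k"
| "arc p (Gate l k) (Out l') \<longleftrightarrow> l' = Suc l \<and> k = 0"
| "arc p (Gate l k) (Ack j) \<longleftrightarrow> j = l \<or> j = Suc l \<and> Suc k = p"
| "arc p (Echo l k) (Relay l' k') \<longleftrightarrow> l' = l \<and> k' = k"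
| "arc p (Echo l k) (Out l') \<longleftrightarrow> l' = l"
| "arc p (Echo l k) (Copy l') \<longleftrightarrow> l' = l \<and> k = 0"
| "arc p (Ack j) (Copy l) \<longleftrightarrow> j = Suc l"
| "arc p (Ack j) (Out l) \<longleftrightarrow> j = Suc l \<or> j = 0 \<and> l = 0"
| "arc p _ _ \<longleftrightarrow> False"

fun is_vertex :: "nat \<Rightarrow> nat \<Rightarrow> node \<Rightarrow> bool" where
  "is_vertex p L (Gate l k) \<longleftrightarrow> l < L \<and> k < p"
| "is_vertex p L (Relay l k) \<longleftrightarrow> l < L \<and> k < p"
| "is_vertex p L (Echo l k) \<longleftrightarrow> l < L \<and> k < p"
| "is_vertex p L (Out l) \<longleftrightarrow> l \<le> L"
| "is_vertex p L (Copy l) \<longleftrightarrow> l < L"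
| "is_vertex p L (Ack j) \<longleftrightarrow> j \<le> L"

definition verts :: "nat \<Rightarrow> nat \<Rightarrow> node set" where
  "verts p L = {v. is_vertex p L v}"

definition edges :: "nat \<Rightarrow> nat \<Rightarrow> node set set" where
  "edges p L = {{u, v} | u v. u \<in> verts p L \<and> v \<in> verts p L \<and> arc p u v}"

definition nbrs :: "nat \<Rightarrow> nat \<Rightarrow> node \<Rightarrow> node set" where
  "nbrs p L v = {u \<in> verts p L. arc p u v \<or> arc p v u}"

fun level :: "node \<Rightarrow> nat" where
  "level (Gate l k) = l" | "level (Relay l k) = l" | "level (Echo l k) = l"
| "level (Out l) = l" | "level (Copy l) = l" | "level (Ack j) = j"

definition block :: "nat \<Rightarrow> nat \<Rightarrow> node set" where
  "block p l = (\<lambda>k. Gate l k) ` {..<p} \<union> (\<lambda>k. Relay l k) ` {..<p} \<union> (\<lambda>k. Echo l k) ` {..<p} \<union>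
     {Out l, Copy l, Ack l}"

lemma finite_block [simp]: "finite (block p l)"
  by (simp add: block_def)

lemma card_block: "card (block p l) \<le> 3 * p + 3"
proof -
  have i: "card (f ` {..<p}) \<le> p" for f :: "nat \<Rightarrow> node"
    using card_image_le[of "{..<p}" f] by simp
  have "card {Out l, Copy l, Ack l} \<le> 3" by simp
  then show ?thesis
    unfolding block_def
    using card_Un_le[of "(\<lambda>k. Gate l k) ` {..<p} \<union> (\<lambda>k. Relay l k) ` {..<p} \<union> (\<lambda>k. Echo l k) ` {..<p}"
        "{Out l, Copy l, Ack l}"]
      card_Un_le[of "(\<lambda>k. Gate l k) ` {..<p} \<union> (\<lambda>k. Relay l k) ` {..<p}" "(\<lambda>k. Echo l k) ` {..<p}"]
      card_Un_le[of "(\<lambda>k. Gate l k) ` {..<p}" "(\<lambda>k. Relay l k) ` {..<p}"]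
      i[of "\<lambda>k. Gate l k"] i[of "\<lambda>k. Relay l k"] i[of "\<lambda>k. Echo l k"]
    by linarith
qed

lemma verts_in_block: "v \<in> verts p L \<Longrightarrow> v \<in> block p (level v) \<and> level v \<le> L"
  by (cases v) (auto simp: verts_def block_def)

lemma finite_verts [simp]: "finite (verts p L)"
proof (rule finite_subset)
  show "verts p L \<subseteq> (\<Union>l\<le>L. block p l)" using verts_in_block by blast
qed simp

lemma card_verts_le: "card (verts p L) \<le> (L + 1) * (3 * p + 3)"
proof -
  have "card (verts p L) \<le> card (\<Union>l\<le>L. block p l)"
    using verts_in_block by (intro card_mono) (simp, blast)
  also have "\<dots> \<le> (\<Sum>l\<le>L. card (block p l))" by (rule card_UN_le) simp
  also have "\<dots> \<le> (\<Sum>l\<le>L. 3 * p + 3)" by (intro sum_mono card_block)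
  finally show ?thesis by simp
qed

lemma card_verts_ge: "L + 1 \<le> card (verts p L)"
proof -
  have "card (Out ` {..L}) \<le> card (verts p L)" by (intro card_mono finite_verts) (auto simp: verts_def)
  then show ?thesis by (simp add: card_image inj_on_def)
qed

lemma finite_edges: "finite (edges p L)"
  by (rule finite_subset[of _ "Pow (verts p L)"]) (auto simp: edges_def)

lemma arc_level: "arc p u v \<Longrightarrow> level u \<le> Suc (level v) \<and> level v \<le> Suc (level u)"
  by (cases "(p, u, v)" rule: arc.cases) auto

lemma arc_irrefl: "\<not> arc p u u"
  by (cases u) auto

text \<open>Every edge lies in two consecutive blocks of bounded size, so even counting all subsets
  of these gives a bound linear in \<open>L\<close>.\<close>

lemma card_edges_le: "card (edges p L) \<le> (L + 1) * 2 ^ (6 * p + 6)"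
proof -
  have "edges p L \<subseteq> (\<Union>l\<le>L. Pow (block p l \<union> block p (Suc l)))"
  proof
    fix e assume "e \<in> edges p L"
    then obtain u v where e: "e = {u, v}" "u \<in> verts p L" "v \<in> verts p L" "arc p u v"
      by (auto simp: edges_def)
    define l where "l = min (level u) (level v)"
    have "level u = l \<or> level u = Suc l" "level v = l \<or> level v = Suc l"
      using arc_level[OF e(4)] by (auto simp: l_def)
    then have "{u, v} \<subseteq> block p l \<union> block p (Suc l)"
      using verts_in_block[OF e(2)] verts_in_block[OF e(3)] by auto
    moreover have "l \<le> L" using verts_in_block[OF e(2)] by (auto simp: l_def)
    ultimately show "e \<in> (\<Union>l\<le>L. Pow (block p l \<union> block p (Suc l)))" using e(1) by blast
  qed
  then have "card (edges p L) \<le> card (\<Union>l\<le>L. Pow (block p l \<union> block p (Suc l)))"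
    by (intro card_mono) auto
  also have "\<dots> \<le> (\<Sum>l\<le>L. card (Pow (block p l \<union> block p (Suc l))))" by (rule card_UN_le) simp
  also have "\<dots> \<le> (\<Sum>l\<le>L. 2 ^ (6 * p + 6))"
  proof (rule sum_mono)
    fix l
    have "card (block p l \<union> block p (Suc l)) \<le> 6 * p + 6"
      using card_Un_le[of "block p l" "block p (Suc l)"] card_block[of p l] card_block[of p "Suc l"]
      by linarith
    then show "card (Pow (block p l \<union> block p (Suc l))) \<le> 2 ^ (6 * p + 6)"
      by (simp add: card_Pow power_increasing)
  qed
  finally show ?thesis by simp
qed

lemma simple_graph_edges: "simple_graph (verts p L) (edges p L)"
proof -
  have "u \<noteq> v" if "arc p u v" for u v using that arc_irrefl by blast
  then show ?thesis by (auto simp: simple_graph_def edges_def nsets_def card_insert_if)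
qed

lemma neighborhood_edges:
  assumes "v \<in> verts p L"
  shows "neighborhood (edges p L) v = nbrs p L v"
  using assms by (auto simp: neighborhood_def edges_def nbrs_def doubleton_eq_iff)

section \<open>Neighbourhoods by vertex type\<close>

lemma nbrs_Gate:
  assumes "l < L" "k < p" "2 \<le> p"
  shows "nbrs p L (Gate l k) = {if k = 0 then Out (Suc l) else Relay l (k - 1), Relay l k,
    if Suc k = p then Ack (Suc l) else Echo l (Suc k), Ack l}"
proof (rule set_eqI)
  fix x show "x \<in> nbrs p L (Gate l k) \<longleftrightarrow> x \<in> {if k = 0 then Out (Suc l) else Relay l (k - 1), Relay l k,
    if Suc k = p then Ack (Suc l) else Echo l (Suc k), Ack l}"
    using assms by (cases x) (auto simp: nbrs_def verts_def)
qed

lemma nbrs_Relay: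
  assumes "l < L" "k < p"
  shows "nbrs p L (Relay l k) = insert (Gate l k)
    (insert (Echo l k) (if Suc k < p then {Gate l (Suc k)} else {}))"
proof (rule set_eqI)
  fix x show "x \<in> nbrs p L (Relay l k) \<longleftrightarrow> x \<in> insert (Gate l k)
    (insert (Echo l k) (if Suc k < p then {Gate l (Suc k)} else {}))"
    using assms by (cases x) (auto simp: nbrs_def verts_def)
qed

lemma nbrs_Echo:
  assumes "l < L" "k < p"
  shows "nbrs p L (Echo l k) = insert (Relay l k) {Out l, if k = 0 then Copy l else Gate l (k - 1)}"
proof (rule set_eqI)
  fix x show "x \<in> nbrs p L (Echo l k) \<longleftrightarrow>
      x \<in> insert (Relay l k) {Out l, if k = 0 then Copy l else Gate l (k - 1)}"
    using assms by (cases x) (auto simp: nbrs_def verts_def)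
qed

lemma nbrs_Copy:
  assumes "l < L" "0 < p"
  shows "nbrs p L (Copy l) = insert (Echo l 0) {Ack (Suc l)}"
proof (rule set_eqI)
  fix x show "x \<in> nbrs p L (Copy l) \<longleftrightarrow> x \<in> insert (Echo l 0) {Ack (Suc l)}"
    using assms by (cases x) (auto simp: nbrs_def verts_def)
qed

lemma nbrs_Out:
  assumes "l < L" "0 < p"
  shows "nbrs p L (Out l) = Echo l ` {..<p} \<union> {Ack (Suc l), if l = 0 then Ack 0 else Gate (l - 1) 0}"
proof (rule set_eqI)
  fix x show "x \<in> nbrs p L (Out l) \<longleftrightarrow>
      x \<in> Echo l ` {..<p} \<union> {Ack (Suc l), if l = 0 then Ack 0 else Gate (l - 1) 0}"
    using assms by (cases x) (auto simp: nbrs_def verts_def)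
qed

lemma nbrs_Out_top:
  assumes "0 < L" "0 < p"
  shows "nbrs p L (Out L) = insert (Gate (L - 1) 0) {}"
proof (rule set_eqI)
  fix x show "x \<in> nbrs p L (Out L) \<longleftrightarrow> x \<in> insert (Gate (L - 1) 0) {}"
    using assms by (cases x) (auto simp: nbrs_def verts_def)
qed

lemma nbrs_Ack_bottom:
  assumes "0 < L" "0 < p"
  shows "nbrs p L (Ack 0) = insert (Out 0) (Gate 0 ` {..<p})"
proof (rule set_eqI)
  fix x show "x \<in> nbrs p L (Ack 0) \<longleftrightarrow> x \<in> insert (Out 0) (Gate 0 ` {..<p})"
    using assms by (cases x) (auto simp: nbrs_def verts_def)
qed

lemma nbrs_Ack:
  assumes "l < L" "0 < p"
  shows "nbrs p L (Ack (Suc l)) = {Out l, Copy l} \<union>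
    (insert (Gate l (p - 1)) (if Suc l < L then Gate (Suc l) ` {..<p} else {}))"
proof (rule set_eqI)
  fix x show "x \<in> nbrs p L (Ack (Suc l)) \<longleftrightarrow> x \<in> {Out l, Copy l} \<union>
    (insert (Gate l (p - 1)) (if Suc l < L then Gate (Suc l) ` {..<p} else {}))"
    using assms by (cases x) (auto simp: nbrs_def verts_def)
qed

lemma nbrs_nonempty:
  assumes "v \<in> verts p L" "0 < L" "2 \<le> p"
  shows "nbrs p L v \<noteq> {}"
proof (cases v)
  case (Out l)
  then show ?thesis
    using assms nbrs_Out[of l L p] nbrs_Out_top[of L p] by (cases "l = L") (auto simp: verts_def)
next
  case (Ack j)
  then show ?thesis
    using assms nbrs_Ack_bottom[of L p] nbrs_Ack[of "j - 1" L p] by (cases j) (auto simp: verts_def)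
qed (use assms in \<open>simp_all add: verts_def nbrs_Gate nbrs_Relay nbrs_Echo nbrs_Copy\<close>)

text \<open>Every ring is ring 0 scaled by \<open>Gam ^ l\<close>, so one set of inequalities serves
  all rings. \<open>Out\<close> and \<open>Copy\<close> weigh the same because \<open>Ack\<close>
  has to treat them alike.\<close>

fun wt :: "real \<Rightarrow> (nat \<Rightarrow> real) \<Rightarrow> (nat \<Rightarrow> real) \<Rightarrow> real \<Rightarrow> real \<Rightarrow> node \<Rightarrow> real" where
  "wt Gam a b eta sig (Gate l k) = Gam ^ l * a k"
| "wt Gam a b eta sig (Relay l k) = Gam ^ l * b k"
| "wt Gam a b eta sig (Echo l k) = Gam ^ l * eta"
| "wt Gam a b eta sig (Out l) = Gam ^ l"
| "wt Gam a b eta sig (Copy l) = Gam ^ l"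
| "wt Gam a b eta sig (Ack j) = Gam ^ j * sig"

text \<open>The adjacent pairs inside one class are exactly gates with echoes and gates with
  acknowledgements. For them equal colours mean counts of equal parity, which is what
  \<open>gate_ready\<close> asks of both acknowledgements.\<close>

fun parity_class :: "node \<Rightarrow> int" where
  "parity_class (Relay l k) = 1" | "parity_class (Out l) = 1" | "parity_class (Copy l) = 1"
| "parity_class _ = 0"

text \<open>With \<open>c\<close> the switch counts, a node follows its driver iff their counts agree, since driver and
  follower lie in different parity classes.\<close>

definition coloring :: "(node \<Rightarrow> int) \<Rightarrow> node \<Rightarrow> color" where
  "coloring c v = (if even (parity_class v + c v) then White else Black)"

lemma coloring_eq_iff:
  "coloring c u = coloring c v \<longleftrightarrow> even (parity_class u + parity_class v + (c u - c v))"
  by (auto simp: coloring_def)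

lemma switch_coloring:
  "switch A (coloring c) = coloring (\<lambda>v. c v + (if v \<in> A then 1 else 0))"
  by (auto simp: switch_def coloring_def)

section \<open>Switchability in terms of switch counts\<close>

text \<open>The inequalities place the threshold of each vertex type, with \<open>Gam ^ l\<close>
  cancelled. Relays, echoes, copies and \<open>Ack 0\<close> obey one heavy neighbour; a gate
  tolerates its relay but not \<open>sig\<close> in addition; an output tolerates one echo but not
  two; a higher \<open>Ack\<close> tolerates neither \<open>Out\<close> nor \<open>Copy\<close>. The
  two values of \<open>x\<close> separate the bottom ring (\<open>out_weights\<close>) or the top
  ring (\<open>ack_weights\<close>) from the others.\<close>

locale gear_train = ring_phase p for p :: nat +
  fixes kap Gam eta sig :: real and a b :: "nat \<Rightarrow> real" and L :: nat
  assumes kap: "0 < kap" "kap < 1 / 2"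
    and L_pos: "0 < L"
    and weights_pos: "0 < Gam" "0 < eta" "0 < sig" "\<And>k. 0 < a k" "\<And>k. 0 < b k"
    and gate_weights: "\<And>k. k < p \<Longrightarrow>
      b k \<le> kap * ((if k = 0 then Gam else b (k - 1)) + b k + (if Suc k = p then Gam * sig else eta) + sig) \<and>
      kap * ((if k = 0 then Gam else b (k - 1)) + b k + (if Suc k = p then Gam * sig else eta) + sig) < b k + sig \<and>
      sig \<le> (if Suc k = p then Gam * sig else eta) \<and>
      b k + sig \<le> (if k = 0 then Gam else b (k - 1))"
    and relay_weights: "\<And>k. k < p \<Longrightarrow>
      eta + (if Suc k < p then a (Suc k) else 0) \<le> kap * (a k + (eta + (if Suc k < p then a (Suc k) else 0)))"
    and echo_weights: "\<And>k. k < p \<Longrightarrow>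
      1 + (if k = 0 then 1 else a (k - 1)) \<le> kap * (b k + (1 + (if k = 0 then 1 else a (k - 1))))"
    and copy_weights: "Gam * sig \<le> kap * (eta + Gam * sig)"
    and out_weights: "\<And>x. x \<in> {a 0 / Gam, sig} \<Longrightarrow>
      eta + (Gam * sig + x) \<le> kap * (p * eta + (Gam * sig + x)) \<and>
      kap * (p * eta + (Gam * sig + x)) < 2 * eta"
    and ack_weights: "\<And>x. x \<in> {a (p - 1), a (p - 1) + Gam * sum a {..<p}} \<Longrightarrow>
      x \<le> kap * (2 + x) \<and> kap * (2 + x) < 1"
    and bottom_weights: "sum a {..<p} \<le> kap * (1 + sum a {..<p})"
begin

abbreviation w :: "node \<Rightarrow> real" where
  "w \<equiv> wt Gam a b eta sig"

abbreviation ready :: "(node \<Rightarrow> int) \<Rightarrow> node \<Rightarrow> bool" where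
  "ready c v \<equiv> switchable (verts p L) (edges p L) w (1 - 2 * kap) (coloring c) v"

lemma w_pos: "0 < w v"
  using weights_pos by (cases v) auto

lemma ready_iff:
  assumes "v \<in> verts p L"
  shows "ready c v \<longleftrightarrow>
    sum w {u \<in> nbrs p L v. coloring c u \<noteq> coloring c v} \<le> kap * sum w (nbrs p L v)"
proof -
  have "opposite_neighbors (edges p L) (coloring c) v = {u \<in> nbrs p L v. coloring c u \<noteq> coloring c v}"
    using assms by (auto simp: opposite_neighbors_def same_neighbors_def neighborhood_edges)
  then show ?thesis
    using assms unfolding switchable_iff_opposite[OF neighborhood_subset(2)[OF simple_graph_edges]]
    by (simp add: neighborhood_edges)
qed

lemma ready_sufficient:
  assumes "v \<in> verts p L" "finite Y" "{u \<in> nbrs p L v. coloring c u \<noteq> coloring c v} \<subseteq> Y"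
    "sum w Y \<le> kap * sum w (nbrs p L v)"
  shows "ready c v"
proof -
  have "sum w {u \<in> nbrs p L v. coloring c u \<noteq> coloring c v} \<le> sum w Y"
    using assms w_pos by (intro sum_mono2) (auto simp: less_imp_le)
  then show ?thesis using assms by (simp add: ready_iff)
qed

lemma ready_necessary:
  assumes "v \<in> verts p L" "ready c v" "X \<subseteq> nbrs p L v" "\<And>u. u \<in> X \<Longrightarrow> coloring c u \<noteq> coloring c v"
  shows "sum w X \<le> kap * sum w (nbrs p L v)"
proof -
  have "sum w X \<le> sum w {u \<in> nbrs p L v. coloring c u \<noteq> coloring c v}"
    using assms w_pos by (intro sum_mono2) (auto simp: less_imp_le nbrs_def)
  then show ?thesis using assms by (simp add: ready_iff)
qed

text \<open>If \<open>u\<close> and \<open>X\<close> were both within the threshold, the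
  neighbourhood weight would be at most \<open>2 * kap < 1\<close> times itself. So a driver whose
  companions fit within the threshold exceeds it alone.\<close>

lemma follower_ready_iff:
  assumes v: "v \<in> verts p L" and N: "nbrs p L v = insert u X" "u \<notin> X" "finite X"
    and X: "sum w X \<le> kap * (w u + sum w X)"
  shows "ready c v \<longleftrightarrow> coloring c u = coloring c v"
proof
  assume "coloring c u = coloring c v"
  then show "ready c v" using N X by (intro ready_sufficient[OF v, of X]) auto
next
  assume r: "ready c v"
  show "coloring c u = coloring c v"
  proof (rule ccontr)
    assume "coloring c u \<noteq> coloring c v"
    then have "w u \<le> kap * (w u + sum w X)" using ready_necessary[OF v r, of "{u}"] N by simp
    then have "w u + sum w X \<le> (2 * kap) * (w u + sum w X)" using X by (simp add: algebra_simps)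
    moreover have "(2 * kap) * (w u + sum w X) < 1 * (w u + sum w X)"
      using kap w_pos[of u] sum_nonneg[of X w] w_pos
      by (intro mult_strict_right_mono) (auto simp: less_imp_le add_pos_nonneg)
    ultimately show False by simp
  qed
qed

lemma scaled:
  assumes "x \<le> kap * y"
  shows "Gam ^ l * x \<le> kap * (Gam ^ l * y)"
  using mult_left_mono[OF assms, of "Gam ^ l"] weights_pos by (simp add: mult.left_commute)

lemma scaled_less:
  assumes "x < y"
  shows "Gam ^ l * x < Gam ^ l * y"
  using assms weights_pos by simp

lemma ready_Relay:
  assumes "l < L" "k < p"
  shows "ready c (Relay l k) \<longleftrightarrow> odd (c (Gate l k) - c (Relay l k))"
proof -
  let ?X = "insert (Echo l k) (if Suc k < p then {Gate l (Suc k)} else {})"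
  have "sum w ?X \<le> kap * (w (Gate l k) + sum w ?X)"
    using scaled[OF relay_weights[OF assms(2)], of l] by (auto simp: algebra_simps)
  then have "ready c (Relay l k) \<longleftrightarrow> coloring c (Gate l k) = coloring c (Relay l k)"
    using assms by (intro follower_ready_iff[OF _ nbrs_Relay]) (auto simp: verts_def)
  then show ?thesis by (simp add: coloring_eq_iff)
qed

lemma ready_Echo:
  assumes "l < L" "k < p"
  shows "ready c (Echo l k) \<longleftrightarrow> odd (c (Relay l k) - c (Echo l k))"
proof -
  let ?X = "{Out l, if k = 0 then Copy l else Gate l (k - 1)}"
  have "sum w ?X \<le> kap * (w (Relay l k) + sum w ?X)"
    using scaled[OF echo_weights[OF assms(2)], of l] by (auto simp: algebra_simps)
  then have "ready c (Echo l k) \<longleftrightarrow> coloring c (Relay l k) = coloring c (Echo l k)"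
    using assms by (intro follower_ready_iff[OF _ nbrs_Echo]) (auto simp: verts_def)
  then show ?thesis by (simp add: coloring_eq_iff)
qed

lemma ready_Copy:
  assumes "l < L"
  shows "ready c (Copy l) \<longleftrightarrow> odd (c (Echo l 0) - c (Copy l))"
proof -
  let ?X = "{Ack (Suc l)}"
  have "sum w ?X \<le> kap * (w (Echo l 0) + sum w ?X)"
    using scaled[OF copy_weights, of l] by (auto simp: algebra_simps)
  then have "ready c (Copy l) \<longleftrightarrow> coloring c (Echo l 0) = coloring c (Copy l)"
    using assms p_pos by (intro follower_ready_iff[OF _ nbrs_Copy]) (auto simp: verts_def)
  then show ?thesis by (simp add: coloring_eq_iff)
qed

lemma ready_Ack_bottom: "ready c (Ack 0) \<longleftrightarrow> odd (c (Out 0) - c (Ack 0))"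
proof -
  let ?X = "Gate 0 ` {..<p}"
  have "sum w ?X = sum a {..<p}" by (subst sum.reindex) (auto simp: inj_on_def)
  then have "sum w ?X \<le> kap * (w (Out 0) + sum w ?X)" using bottom_weights by simp
  then have "ready c (Ack 0) \<longleftrightarrow> coloring c (Out 0) = coloring c (Ack 0)"
    using L_pos p_pos by (intro follower_ready_iff[OF _ nbrs_Ack_bottom]) (auto simp: verts_def)
  then show ?thesis by (simp add: coloring_eq_iff)
qed

lemma ready_Out_top: "ready c (Out L) \<longleftrightarrow> odd (c (Gate (L - 1) 0) - c (Out L))"
proof -
  have "ready c (Out L) \<longleftrightarrow> coloring c (Gate (L - 1) 0) = coloring c (Out L)"
    using L_pos p_pos kap w_pos[of "Gate (L - 1) 0"]
    by (intro follower_ready_iff[OF _ nbrs_Out_top]) (auto simp: verts_def simp del: wt.simps)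
  then show ?thesis by (simp add: coloring_eq_iff)
qed

lemma ready_Ack:
  assumes "l < L"
  shows "ready c (Ack (Suc l)) \<longleftrightarrow>
    odd (c (Out l) - c (Ack (Suc l))) \<and> odd (c (Copy l) - c (Ack (Suc l)))"
proof -
  let ?v = "Ack (Suc l)"
  let ?X = "insert (Gate l (p - 1)) (if Suc l < L then Gate (Suc l) ` {..<p} else {})"
  define x where "x = (if Suc l < L then a (p - 1) + Gam * sum a {..<p} else a (p - 1))"
  have X: "sum w ?X = Gam ^ l * x"
  proof (cases "Suc l < L")
    case True
    have "sum w (Gate (Suc l) ` {..<p}) = Gam ^ l * (Gam * sum a {..<p})"
      by (subst sum.reindex) (auto simp: inj_on_def sum_distrib_left mult_ac)
    moreover have "sum w ?X = w (Gate l (p - 1)) + sum w (Gate (Suc l) ` {..<p})"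
      using True by (simp add: image_iff del: wt.simps)
    ultimately show ?thesis using True by (simp add: x_def algebra_simps)
  qed (simp add: x_def)
  have x: "x \<le> kap * (2 + x)" "kap * (2 + x) < 1" using ack_weights[of x] by (auto simp: x_def)
  have v: "?v \<in> verts p L" using assms by (simp add: verts_def)
  have N: "nbrs p L ?v = {Out l, Copy l} \<union> ?X" using nbrs_Ack[OF assms p_pos] .
  have "sum w ({Out l, Copy l} \<union> ?X) = sum w {Out l, Copy l} + sum w ?X"
    by (rule sum.union_disjoint) auto
  then have W: "sum w (nbrs p L ?v) = Gam ^ l * (2 + x)" using N X by (simp add: algebra_simps)
  have "ready c ?v \<longleftrightarrow> coloring c (Out l) = coloring c ?v \<and> coloring c (Copy l) = coloring c ?v"
  proof
    assume "coloring c (Out l) = coloring c ?v \<and> coloring c (Copy l) = coloring c ?v"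
    then show "ready c ?v"
      using N X W scaled[OF x(1), of l] by (intro ready_sufficient[OF v, of ?X]) auto
  next
    assume r: "ready c ?v"
    have "coloring c y = coloring c ?v" if "y \<in> {Out l, Copy l}" for y
    proof (rule ccontr)
      assume "coloring c y \<noteq> coloring c ?v"
      then have "w y \<le> kap * (Gam ^ l * (2 + x))"
        using ready_necessary[OF v r, of "{y}"] N W that by auto
      moreover have "w y = Gam ^ l" using that by auto
      ultimately show False using scaled_less[OF x(2), of l] by (simp add: mult.left_commute)
    qed
    then show "coloring c (Out l) = coloring c ?v \<and> coloring c (Copy l) = coloring c ?v" by simp
  qed
  then show ?thesis by (simp add: coloring_eq_iff)
qed

lemma ready_Out:
  assumes l: "l < L"
  shows "ready c (Out l) \<longleftrightarrow> out_ready (\<lambda>k. c (Echo l k)) (c (Out l))"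
proof -
  let ?v = "Out l"
  let ?X = "{Ack (Suc l), if l = 0 then Ack 0 else Gate (l - 1) 0}"
  define x where "x = (if l = 0 then sig else a 0 / Gam)"
  have "Gam ^ l * (a 0 / Gam) = Gam ^ (l - 1) * a 0" if "0 < l"
    using that weights_pos by (cases l) auto
  then have X: "sum w ?X = Gam ^ l * (Gam * sig + x)" by (auto simp: x_def algebra_simps)
  have x: "eta + (Gam * sig + x) \<le> kap * (p * eta + (Gam * sig + x))"
      "kap * (p * eta + (Gam * sig + x)) < 2 * eta"
    using out_weights[of x] by (auto simp: x_def)
  have v: "?v \<in> verts p L" using l by (simp add: verts_def)
  have N: "nbrs p L ?v = Echo l ` {..<p} \<union> ?X" using nbrs_Out[OF l p_pos] .
  have "sum w (Echo l ` {..<p} \<union> ?X) = sum w (Echo l ` {..<p}) + sum w ?X"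
    by (rule sum.union_disjoint) auto
  moreover have "sum w (Echo l ` {..<p}) = Gam ^ l * (p * eta)"
    by (subst sum.reindex) (auto simp: inj_on_def)
  ultimately have W: "sum w (nbrs p L ?v) = Gam ^ l * (p * eta + (Gam * sig + x))"
    using N X by (simp add: algebra_simps)
  have col: "coloring c (Echo l k) \<noteq> coloring c ?v \<longleftrightarrow> even (c (Echo l k) - c ?v)" for k
    by (simp add: coloring_eq_iff)
  show ?thesis
  proof
    assume r: "ready c ?v"
    show "out_ready (\<lambda>k. c (Echo l k)) (c (Out l))"
      unfolding out_ready_def
    proof (intro allI impI)
      fix i j assume ij: "i < p" "j < p" "even (c (Echo l i) - c ?v)" "even (c (Echo l j) - c ?v)"
      show "i = j"
      proof (rule ccontr)
        assume "i \<noteq> j"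
        then have "sum w {Echo l i, Echo l j} = Gam ^ l * (2 * eta)" by simp
        moreover have "coloring c (Echo l i) \<noteq> coloring c ?v" "coloring c (Echo l j) \<noteq> coloring c ?v"
          using ij col by blast+
        then have "sum w {Echo l i, Echo l j} \<le> kap * sum w (nbrs p L ?v)"
          using ij N by (intro ready_necessary[OF v r]) auto
        ultimately show False using W scaled_less[OF x(2), of l] by (simp add: mult.left_commute)
      qed
    qed
  next
    assume z: "out_ready (\<lambda>k. c (Echo l k)) (c (Out l))"
    \<comment> \<open>If no echo disagrees, any \<open>j\<close> will do: the set below only has to
      contain the disagreeing neighbours.\<close>
    obtain j where j: "\<And>k. k < p \<Longrightarrow> coloring c (Echo l k) \<noteq> coloring c ?v \<Longrightarrow> k = j"
      using z unfolding out_ready_def col[symmetric] by metis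
    have "sum w (insert (Echo l j) ?X) = w (Echo l j) + sum w ?X" by (rule sum.insert) auto
    then have "sum w (insert (Echo l j) ?X) = Gam ^ l * (eta + (Gam * sig + x))"
      unfolding X by (simp add: distrib_left)
    then show "ready c ?v"
      using N W scaled[OF x(1), of l] j
      by (intro ready_sufficient[OF v, of "insert (Echo l j) ?X"]) auto
  qed
qed

text \<open>The threshold lies between \<open>b k\<close> and \<open>b k + sig\<close>. An inactive
  input alone exceeds it; with an active input the settled relay has the opposite colour and uses up
  \<open>b k\<close>, so neither light acknowledgement may disagree.\<close>

lemma ready_Gate:
  assumes l: "l < L" and k: "k < p"
    and settled: "odd ((if k = 0 then c (Out (Suc l)) else c (Relay l (k - 1))) - c (Gate l k)) \<Longrightarrow>
      c (Relay l k) = c (Gate l k)"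
  shows "ready c (Gate l k) \<longleftrightarrow> gate_ready (\<lambda>k. c (Gate l k)) (\<lambda>k. c (Relay l k)) (\<lambda>k. c (Echo l k))
    (c (Out (Suc l))) (c (Ack (Suc l))) (c (Ack l)) k"
proof -
  let ?v = "Gate l k"
  define i where "i = (if k = 0 then Out (Suc l) else Relay l (k - 1))"
  define q where "q = (if Suc k = p then Ack (Suc l) else Echo l (Suc k))"
  define wi where "wi = (if k = 0 then Gam else b (k - 1))"
  define wq where "wq = (if Suc k = p then Gam * sig else eta)"
  have p2: "2 \<le> p" using p_ge_3 by simp
  have v: "?v \<in> verts p L" using l k by (simp add: verts_def)
  have N: "nbrs p L ?v = {i, Relay l k, q, Ack l}" using nbrs_Gate[OF l k p2] by (simp add: i_def q_def)
  have dist: "i \<noteq> Relay l k" "i \<noteq> q" "i \<noteq> Ack l" "Relay l k \<noteq> q" "q \<noteq> Ack l"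
    by (auto simp: i_def q_def)
  have wts: "w i = Gam ^ l * wi" "w q = Gam ^ l * wq" by (simp_all add: i_def q_def wi_def wq_def)
  have W: "sum w (nbrs p L ?v) = Gam ^ l * (wi + b k + wq + sig)"
    using N dist wts by (simp add: algebra_simps)
  have G: "b k \<le> kap * (wi + b k + wq + sig)" "kap * (wi + b k + wq + sig) < b k + sig"
      "sig \<le> wq" "b k + sig \<le> wi"
    using gate_weights[OF k] by (simp_all add: wi_def wq_def)
  have less: "kap * sum w (nbrs p L ?v) < Gam ^ l * (b k + sig)"
    using scaled_less[OF G(2), of l] W by (simp add: mult.left_commute)
  have col: "coloring c i = coloring c ?v \<longleftrightarrow> odd (c i - c ?v)"
      "coloring c (Relay l k) = coloring c ?v \<longleftrightarrow> odd (c (Relay l k) - c ?v)"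
      "coloring c q = coloring c ?v \<longleftrightarrow> even (c q - c ?v)"
      "coloring c (Ack l) = coloring c ?v \<longleftrightarrow> even (c (Ack l) - c ?v)"
    by (auto simp: coloring_eq_iff i_def q_def)
  have nr: "gate_ready (\<lambda>k. c (Gate l k)) (\<lambda>k. c (Relay l k)) (\<lambda>k. c (Echo l k))
      (c (Out (Suc l))) (c (Ack (Suc l))) (c (Ack l)) k \<longleftrightarrow>
      odd (c i - c ?v) \<and> even (c q - c ?v) \<and> even (c (Ack l) - c ?v)"
    by (simp add: gate_ready_def i_def q_def if_distrib[of c])
  have set: "odd (c i - c ?v) \<Longrightarrow> c (Relay l k) = c ?v"
    using settled by (simp add: i_def split: if_splits)
  show ?thesis
    unfolding nr
  proof
    assume o: "odd (c i - c ?v) \<and> even (c q - c ?v) \<and> even (c (Ack l) - c ?v)"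
    have "w (Relay l k) \<le> kap * sum w (nbrs p L ?v)" using scaled[OF G(1), of l] W by simp
    then show "ready c ?v"
      using N o col by (intro ready_sufficient[OF v, of "{Relay l k}"]) auto
  next
    assume r: "ready c ?v"
    have odd: "odd (c i - c ?v)"
    proof (rule ccontr)
      assume "\<not> ?thesis"
      then have "w i \<le> kap * sum w (nbrs p L ?v)"
        using ready_necessary[OF v r, of "{i}"] N col by auto
      moreover have "Gam ^ l * (b k + sig) \<le> w i" using G(4) wts weights_pos by simp
      ultimately show False using less by linarith
    qed
    have tips: "coloring c y = coloring c ?v" if y: "y \<in> {q, Ack l}" for y
    proof (rule ccontr)
      assume n: "coloring c y \<noteq> coloring c ?v"
      have "sum w {Relay l k, y} \<le> kap * sum w (nbrs p L ?v)"
        using n y N col set[OF odd] by (intro ready_necessary[OF v r]) auto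
      moreover have "sum w {Relay l k, y} = w (Relay l k) + w y" using y dist by auto
      moreover have "Gam ^ l * sig \<le> w y" using y wts G(3) weights_pos by auto
      ultimately show False using less by (simp add: algebra_simps)
    qed
    show "odd (c i - c ?v) \<and> even (c q - c ?v) \<and> even (c (Ack l) - c ?v)"
      using odd tips[of q] tips[of "Ack l"] col by simp
  qed
qed

end

section \<open>Runs on the chain of rings\<close>

fun (in ring_phase) initial_count :: "node \<Rightarrow> int" where
  "initial_count (Gate l k) = gate_count k 0"
| "initial_count (Relay l k) = gate_count k 0"
| "initial_count (Echo l k) = gate_count k 0"
| "initial_count _ = 0"

context gear_train
begin

text \<open>Only the ends need extra clauses: \<open>Ack 0\<close> belongs to no ring, and
  \<open>Out L\<close> depends on \<open>Gate (L - 1) 0\<close> alone, neither of which ever moves.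
  Nonnegativity serves the growth estimate at the top ring.\<close>

definition gear_inv :: "(node \<Rightarrow> int) \<Rightarrow> bool" where
  "gear_inv c \<longleftrightarrow>
     (\<forall>l<L. level_inv (\<lambda>k. c (Gate l k)) (\<lambda>k. c (Relay l k)) (\<lambda>k. c (Echo l k))
        (c (Out l)) (c (Out (Suc l))) (c (Copy l)) (c (Ack (Suc l))) (c (Ack l))) \<and>
     c (Out 0) - 1 \<le> c (Ack 0) \<and> c (Ack 0) \<le> c (Out 0) \<and>
     c (Out L) = 0 \<and> c (Gate (L - 1) 0) = 0 \<and> (\<forall>l\<le>L. 0 \<le> c (Out l))"

lemma gear_inv_initial: "gear_inv initial_count"
proof -
  have g0: "gate_count 0 0 = 0" by (simp add: gate_count_def skips_def)
  have "gate_count k 0 \<le> gate_count k (0 + 1)" for k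
    unfolding gate_count_Suc_time by simp
  then have "level_inv (\<lambda>k. gate_count k 0) (\<lambda>k. gate_count k 0) (\<lambda>k. gate_count k 0) 0 0 0 0 0"
    using g0 gate_count_Suc_index[of _ 0] by (auto simp: level_inv_def)
  then show ?thesis using g0 by (auto simp: gear_inv_def)
qed

context
  fixes c :: "node \<Rightarrow> int"
  assumes inv: "gear_inv c"
begin

lemma level_invD:
  "l < L \<Longrightarrow> level_inv (\<lambda>k. c (Gate l k)) (\<lambda>k. c (Relay l k)) (\<lambda>k. c (Echo l k))
        (c (Out l)) (c (Out (Suc l))) (c (Copy l)) (c (Ack (Suc l))) (c (Ack l))"
  using inv by (simp add: gear_inv_def)

lemma ack_bounds:
  assumes "l < L"
  shows "c (Out l) - 1 \<le> c (Ack l)" "c (Ack l) \<le> c (Out l)"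
proof -
  show "c (Out l) - 1 \<le> c (Ack l)" "c (Ack l) \<le> c (Out l)"
    using inv inv_ends[OF level_invD[of "l - 1"]] assms
    by (cases l; force simp: gear_inv_def)+
qed

lemma ready_Relay_iff:
  assumes "l < L" "k < p"
  shows "ready c (Relay l k) \<longleftrightarrow> c (Relay l k) \<noteq> c (Gate l k)"
proof -
  have "c (Gate l k) = c (Relay l k) \<or> c (Gate l k) = c (Relay l k) + 1"
    using inv_chain(2,3,6)[OF level_invD[OF assms(1)] assms(2)] by linarith
  then show ?thesis unfolding ready_Relay[OF assms] by auto
qed

lemma ready_Echo_iff:
  assumes "l < L" "k < p"
  shows "ready c (Echo l k) \<longleftrightarrow> c (Echo l k) \<noteq> c (Relay l k)"
proof -
  have "c (Relay l k) = c (Echo l k) \<or> c (Relay l k) = c (Echo l k) + 1"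
    using inv_chain(2,3,6)[OF level_invD[OF assms(1)] assms(2)] by linarith
  then show ?thesis unfolding ready_Echo[OF assms] by auto
qed

lemma ready_Copy_iff:
  assumes "l < L"
  shows "ready c (Copy l) \<longleftrightarrow> c (Copy l) \<noteq> c (Echo l 0)"
proof -
  have "c (Echo l 0) = c (Copy l) \<or> c (Echo l 0) = c (Copy l) + 1"
    using inv_ends(1,2,3,7)[OF level_invD[OF assms]] by linarith
  then show ?thesis unfolding ready_Copy[OF assms] by auto
qed

lemma ready_Ack_iff:
  assumes "l < L"
  shows "ready c (Ack (Suc l)) \<longleftrightarrow> ack_ready (c (Copy l)) (c (Ack (Suc l))) (c (Out l))"
proof -
  have "c (Copy l) = c (Ack (Suc l)) \<or> c (Copy l) = c (Ack (Suc l)) + 1"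
    using inv_ends(2,8)[OF level_invD[OF assms]] by linarith
  then show ?thesis unfolding ready_Ack[OF assms] ack_ready_def by auto
qed

lemma ready_Ack_bottom_iff: "ready c (Ack 0) \<longleftrightarrow> c (Ack 0) \<noteq> c (Out 0)"
proof -
  have "c (Out 0) = c (Ack 0) \<or> c (Out 0) = c (Ack 0) + 1"
    using ack_bounds[OF L_pos] by linarith
  then show ?thesis unfolding ready_Ack_bottom by auto
qed

lemma ready_Gate_iff:
  assumes "l < L" "k < p"
  shows "ready c (Gate l k) \<longleftrightarrow> gate_ready (\<lambda>k. c (Gate l k)) (\<lambda>k. c (Relay l k)) (\<lambda>k. c (Echo l k))
    (c (Out (Suc l))) (c (Ack (Suc l))) (c (Ack l)) k"
  using assms odd_inputD(3)[OF level_invD[OF assms(1)] assms(2)] by (intro ready_Gate)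

lemma not_ready_Out_top: "\<not> ready c (Out L)"
  using inv by (simp add: ready_Out_top gear_inv_def)

lemma gear_inv_step:
  assumes A: "\<And>v. v \<in> A \<Longrightarrow> ready c v"
  shows "gear_inv (\<lambda>v. c v + (if v \<in> A then 1 else 0))"
proof -
  define c' where "c' = (\<lambda>v. c v + (if v \<in> A then 1 else 0))"
  have step: "c' v = c v \<or> c' v = c v + 1 \<and> ready c v" for v
    using A by (auto simp: c'_def)
  have mono: "c v \<le> c' v" for v using step[of v] by auto
  have top: "c' (Out L) = 0"
    using step[of "Out L"] not_ready_Out_top inv by (auto simp: gear_inv_def)
  \<comment> \<open>An output moves only after its acknowledgement has caught up; for the ring below
    this is the condition on its input \<open>u\<close>.\<close>
  have out_ack: "c (Ack l) = c (Out l)" if "l \<le> L" "0 < l" "c' (Out l) \<noteq> c (Out l)" for l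
  proof -
    have "ready c (Out l)" using step[of "Out l"] that by auto
    moreover from this have "l < L" using not_ready_Out_top that by (cases "l = L") auto
    ultimately show ?thesis using ready_Out out_readyD(4)[OF level_invD] by blast
  qed
  have bottom: "c' (Out 0) - 1 \<le> c' (Ack 0) \<and> c' (Ack 0) \<le> c' (Out 0)"
  proof -
    have "ready c (Ack 0) \<Longrightarrow> c (Ack 0) < c (Out 0)"
      using ready_Ack_bottom_iff ack_bounds[OF L_pos] by linarith
    moreover have "ready c (Out 0) \<Longrightarrow> c (Ack 0) = c (Out 0)"
      using ready_Out[OF L_pos] out_readyD(4)[OF level_invD[OF L_pos]] by blast
    ultimately show ?thesis
      using step[of "Ack 0"] step[of "Out 0"] ack_bounds[OF L_pos] by auto
  qed
  have one: "level_inv (\<lambda>k. c' (Gate l k)) (\<lambda>k. c' (Relay l k)) (\<lambda>k. c' (Echo l k))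
        (c' (Out l)) (c' (Out (Suc l))) (c' (Copy l)) (c' (Ack (Suc l))) (c' (Ack l))"
    if l: "l < L" and le: "c' (Ack l) \<le> c' (Out l)" for l
  proof (rule level_inv_step[OF level_invD[OF l] ack_bounds[OF l] mono le])
    fix k assume k: "k < p"
    show "c' (Gate l k) = c (Gate l k) \<or> c' (Gate l k) = c (Gate l k) + 1 \<and>
        gate_ready (\<lambda>k. c (Gate l k)) (\<lambda>k. c (Relay l k)) (\<lambda>k. c (Echo l k))
          (c (Out (Suc l))) (c (Ack (Suc l))) (c (Ack l)) k"
      using step[of "Gate l k"] ready_Gate_iff[OF l k] by simp
    show "c' (Relay l k) = c (Relay l k) \<or> c' (Relay l k) = c (Relay l k) + 1 \<and> c (Relay l k) \<noteq> c (Gate l k)"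
      using step[of "Relay l k"] ready_Relay_iff[OF l k] by simp
    show "c' (Echo l k) = c (Echo l k) \<or> c' (Echo l k) = c (Echo l k) + 1 \<and> c (Echo l k) \<noteq> c (Relay l k)"
      using step[of "Echo l k"] ready_Echo_iff[OF l k] by simp
  next
    show "c' (Copy l) = c (Copy l) \<or> c' (Copy l) = c (Copy l) + 1 \<and> c (Copy l) \<noteq> c (Echo l 0)"
      using step[of "Copy l"] ready_Copy_iff[OF l] by simp
    show "c' (Ack (Suc l)) = c (Ack (Suc l)) \<or> c' (Ack (Suc l)) = c (Ack (Suc l)) + 1 \<and>
        ack_ready (c (Copy l)) (c (Ack (Suc l))) (c (Out l))"
      using step[of "Ack (Suc l)"] ready_Ack_iff[OF l] by simp
    show "c' (Out l) = c (Out l) \<or> c' (Out l) = c (Out l) + 1 \<and> out_ready (\<lambda>k. c (Echo l k)) (c (Out l))"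
      using step[of "Out l"] ready_Out[OF l] by simp
    show "c' (Out (Suc l)) = c (Out (Suc l)) \<or>
        c' (Out (Suc l)) = c (Out (Suc l)) + 1 \<and> c (Ack (Suc l)) = c (Out (Suc l))"
      using step[of "Out (Suc l)"] out_ack[of "Suc l"] l by auto
  qed
  \<comment> \<open>Ring \<open>Suc l\<close> needs the bound on its acknowledgement in the new
    state, which the new invariant of ring \<open>l\<close> supplies; hence induction from the
    bottom.\<close>
  have lev: "l < L \<Longrightarrow> level_inv (\<lambda>k. c' (Gate l k)) (\<lambda>k. c' (Relay l k)) (\<lambda>k. c' (Echo l k))
        (c' (Out l)) (c' (Out (Suc l))) (c' (Copy l)) (c' (Ack (Suc l))) (c' (Ack l))" for l
  proof (induction l)
    case (Suc l)
    have "c' (Ack (Suc l)) \<le> c' (Out (Suc l))"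
      using inv_ends(2,3,7)[OF Suc.IH] Suc.prems by simp
    then show ?case using one Suc.prems by blast
  qed (use one bottom in blast)
  have "c' (Gate (L - 1) 0) \<le> 0"
    using inv_ends(4)[OF lev[of "L - 1"]] top L_pos by simp
  then have gate0: "c' (Gate (L - 1) 0) = 0"
    using mono[of "Gate (L - 1) 0"] inv by (simp add: gear_inv_def)
  have "0 \<le> c' (Out l)" if "l \<le> L" for l
    using mono[of "Out l"] inv that by (force simp: gear_inv_def)
  then have "gear_inv c'"
    using lev bottom top gate0 unfolding gear_inv_def by blast
  then show ?thesis by (simp add: c'_def)
qed

text \<open>Goes upward from ring 0: a stuck ring \<open>l\<close> has \<open>Ack (Suc l)\<close>
  caught up, which is the assumption \<open>d = t\<close> of \<open>stuck_level\<close> for the next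
  ring.\<close>

lemma stuck_counts:
  assumes st: "\<And>v. v \<in> verts p L \<Longrightarrow> \<not> ready c v"
  shows "l < L \<Longrightarrow> 2 \<le> c (Out l) mod int p \<and> c (Out (Suc l)) = gate_count 0 (c (Out l)) \<and>
    c (Ack (Suc l)) = c (Out (Suc l))"
proof (induction l)
  have one: "2 \<le> c (Out l) mod int p \<and> c (Out (Suc l)) = gate_count 0 (c (Out l)) \<and>
      c (Ack (Suc l)) = c (Out (Suc l))" if l: "l < L" and d: "c (Ack l) = c (Out l)" for l
  proof (rule stuck_level[OF level_invD[OF l] d])
    fix k assume k: "k < p"
    show "c (Relay l k) = c (Gate l k)" "c (Echo l k) = c (Relay l k)"
      using st[of "Relay l k"] st[of "Echo l k"] ready_Relay_iff[OF l k] ready_Echo_iff[OF l k] l k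
      by (simp_all add: verts_def)
    show "\<not> gate_ready (\<lambda>k. c (Gate l k)) (\<lambda>k. c (Relay l k)) (\<lambda>k. c (Echo l k))
        (c (Out (Suc l))) (c (Ack (Suc l))) (c (Ack l)) k"
      using st[of "Gate l k"] ready_Gate_iff[OF l k] l k by (simp add: verts_def)
  next
    show "c (Copy l) = c (Echo l 0)" "\<not> ack_ready (c (Copy l)) (c (Ack (Suc l))) (c (Out l))"
        "\<not> out_ready (\<lambda>k. c (Echo l k)) (c (Out l))"
      using st[of "Copy l"] st[of "Ack (Suc l)"] st[of "Out l"] ready_Copy_iff[OF l]
        ready_Ack_iff[OF l] ready_Out[OF l] l
      by (simp_all add: verts_def)
  qed
  {
    case 0
    have "c (Ack 0) = c (Out 0)" using st[of "Ack 0"] ready_Ack_bottom_iff by (simp add: verts_def)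
    then show ?case using one 0 by blast
  next
    case (Suc l)
    then have "c (Ack (Suc l)) = c (Out (Suc l))" by simp
    then show ?case using one Suc.prems by blast
  }
qed

text \<open>Goes downward from the top ring, with \<open>j\<close> the distance to it; its output
  has switched at least twice, and each lower ring gains the factor of
  \<open>gate_count_growth\<close>.\<close>

lemma stuck_growth:
  assumes st: "\<And>v. v \<in> verts p L \<Longrightarrow> \<not> ready c v"
  shows "j < L \<Longrightarrow> 2 * (real p / real (p - 2)) ^ j \<le> real_of_int (c (Out (L - 1 - j)))"
proof (induction j)
  case 0
  have l: "L - 1 < L" using L_pos by simp
  have "gate_count 0 (c (Out (L - 1))) = 0"
    using stuck_counts[OF st l] inv L_pos by (simp add: gear_inv_def)
  moreover have "0 \<le> c (Out (L - 1))" using inv by (simp add: gear_inv_def)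
  ultimately have "2 \<le> c (Out (L - 1))" using gate_count_growth(2) stuck_counts[OF st l] by blast
  then show ?case by simp
next
  case (Suc j)
  define l where "l = L - 1 - Suc j"
  have l: "l < L" "Suc l = L - 1 - j" using Suc.prems by (auto simp: l_def)
  have "int p * c (Out (Suc l)) \<le> (int p - 2) * c (Out l)"
    using gate_count_growth(1) stuck_counts[OF st l(1)] by simp
  then have "real_of_int (int p * c (Out (Suc l))) \<le> real_of_int ((int p - 2) * c (Out l))"
    by (simp only: of_int_le_iff)
  then have "real p * real_of_int (c (Out (Suc l))) \<le> real (p - 2) * real_of_int (c (Out l))"
    using p_ge_3 by (simp add: of_nat_diff)
  then have "real p / real (p - 2) * real_of_int (c (Out (Suc l))) \<le> real_of_int (c (Out l))"
    using p_ge_3 by (simp add: field_simps)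
  moreover have "real p / real (p - 2) * (2 * (real p / real (p - 2)) ^ j)
      \<le> real p / real (p - 2) * real_of_int (c (Out (Suc l)))"
    using Suc l by (intro mult_left_mono) auto
  ultimately show ?case by (simp add: l_def mult.left_commute)
qed

end

lemma stabilization_lower_bound:
  assumes run: "minority_run M (verts p L) (edges p L) w (1 - 2 * kap) (coloring initial_count) T S"
    and st: "stable (verts p L) (edges p L) w (1 - 2 * kap) (S T)"
  shows "2 * (real p / real (p - 2)) ^ (L - 1) \<le> real T"
proof -
  \<comment> \<open>A count grows by at most 1 per step, however many vertices switch at once, so
    \<open>c (Out 0)\<close> bounds the number of steps from below.\<close>
  have "i \<le> T \<Longrightarrow> \<exists>c. S i = coloring c \<and> gear_inv c \<and> c (Out 0) \<le> int i" for i
  proof (induction i)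
    case 0
    then show ?case using run gear_inv_initial
      by (intro exI[of _ initial_count]) (simp add: minority_run_def)
  next
    case (Suc i)
    then obtain c where c: "S i = coloring c" "gear_inv c" "c (Out 0) \<le> int i" by auto
    have "\<exists>A. admissible M A \<and> A \<subseteq> {v. ready c v} \<and> S (Suc i) = switch A (S i)"
      using run Suc.prems c(1) unfolding minority_run_def by (metis Suc_le_lessD)
    then obtain A where A: "A \<subseteq> {v. ready c v}" "S (Suc i) = switch A (S i)" by blast
    let ?c = "\<lambda>v. c v + (if v \<in> A then 1 else 0)"
    have "gear_inv ?c" using gear_inv_step[OF c(2)] A(1) by auto
    moreover have "S (Suc i) = coloring ?c" using A(2) c(1) switch_coloring by simp
    ultimately show ?case using c(3) by (intro exI[of _ ?c]) auto
  qed
  then obtain c where c: "S T = coloring c" "gear_inv c" "c (Out 0) \<le> int T" by blast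
  have "\<not> ready c v" if "v \<in> verts p L" for v using st that c(1) by (simp add: stable_def)
  then have "2 * (real p / real (p - 2)) ^ (L - 1) \<le> real_of_int (c (Out (L - 1 - (L - 1))))"
    using L_pos by (intro stuck_growth[OF c(2)]) auto
  also have "\<dots> \<le> real T" using c(3) by simp
  finally show ?thesis .
qed

end

section \<open>Choice of the weights\<close>

text \<open>The constants depend on \<open>lam\<close> only, so one choice serves every
  \<open>L\<close>. The order avoids circularity: \<open>eta\<close> and \<open>s\<close> are fixed
  first, the relay weights are built from them and end in \<open>Gam\<close>, and
  \<open>sig = s / Gam\<close> comes last.\<close>

lemma gear_weights_exist:
  fixes lam :: real
  assumes lam: "0 < lam" "lam < 1"
  obtains p Gam eta sig a b where "\<And>L. 0 < L \<Longrightarrow> gear_train p ((1 - lam) / 2) Gam eta sig a b L"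
proof -
  define kap where "kap = (1 - lam) / 2"
  have kap: "0 < kap" "kap < 1 / 2" "2 * kap = 1 - lam" using lam by (auto simp: kap_def)
  define p where "p = nat \<lfloor>1 / kap\<rfloor> + 1"
  have "2 < 1 / kap" using kap by (simp add: field_simps)
  then have "2 \<le> \<lfloor>1 / kap\<rfloor>" by (simp add: le_floor_iff)
  then have p3: "3 \<le> p" unfolding p_def by linarith
  have p_real: "real p = of_int \<lfloor>1 / kap\<rfloor> + 1" using kap by (simp add: p_def)
  \<comment> \<open>\<open>eta * th\<close> is the room that the echoes leave in the threshold of an
    output beyond one tolerated echo.\<close>
  define th where "th = kap * real p - 1"
  have "1 / kap < real p" "real p \<le> 1 / kap + 1" unfolding p_real by linarith+
  then have th: "0 < th" "th \<le> kap" using kap by (auto simp: th_def field_simps)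
  \<comment> \<open>The ratio of domination: \<open>x \<le> kap * (y + x)\<close> iff
    \<open>rho * x \<le> y\<close>.\<close>
  define rho where "rho = (1 - kap) / kap"
  have rho1: "kap * (rho + 1) = 1" using kap by (simp add: rho_def field_simps)
  have rho_less: "1 < rho" using kap by (simp add: rho_def field_simps)
  have dominated: "x \<le> kap * (y + x)" if "rho * x \<le> y" for x y
  proof -
    have "kap * (rho * x) + kap * x = x" using rho1 by (metis distrib_left distrib_right mult.assoc mult_1 mult.right_neutral)
    moreover have "kap * (rho * x) \<le> kap * y" using that kap by simp
    ultimately show ?thesis by (simp add: distrib_left)
  qed
  define D where "D = (2 * rho) ^ p"
  \<comment> \<open>\<open>C\<close> bounds the relay weights and \<open>Gam\<close> from below;
    this value keeps the weight \<open>a 0 / Gam\<close> of a gate next to its driving output at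
    most \<open>eta * th / 2\<close>.\<close>
  define C where "C = 2 * D / th"
  \<comment> \<open>\<open>mu\<close> bounds the gate weight around an \<open>Ack\<close>: the part
    \<open>2 * kap\<close> keeps it within the threshold, the part \<open>lam\<close> keeps
    \<open>kap * (2 + mu)\<close> below 1.\<close>
  define mu where "mu = min (2 * kap) lam"
  \<comment> \<open>The denominator bounds \<open>(1 + Gam) * rho * A / eta\<close> for the sum
    \<open>A\<close> of the gate weights, as \<open>Gam \<le> rho ^ p * C\<close> and
    \<open>A \<le> p * eta * D\<close>.\<close>
  define eta where "eta = mu / ((1 + rho ^ p * C) * real p * D * rho)"
  have D: "2 * rho \<le> D"
    unfolding D_def using self_le_power[of "2 * rho" p] rho_less p3 by simp
  have C: "4 * rho \<le> C"
  proof -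
    have "2 * D \<le> 2 * D / th" using th kap D rho_less by (simp add: field_simps)
    then show ?thesis using D by (simp add: C_def)
  qed
  have mu: "0 < mu" "mu \<le> 2 * kap" "mu \<le> lam" using kap lam by (auto simp: mu_def)
  have eta: "0 < eta"
    unfolding eta_def using mu C D rho_less p3 by (intro divide_pos_pos mult_pos_pos add_pos_pos) auto
  define a where "a = (\<lambda>k. eta * (2 * rho) ^ (p - k))"
  define s where "s = eta * th / (2 * rho)"
  \<comment> \<open>Relay weights, counted back from the last gate. The recursion solves
    \<open>kap * (input + b k + tip) = b k\<close> for the input weight, which puts the threshold of
    a gate at exactly \<open>b k + kap * sig\<close>. Index 0 is the last gate, whose tip is
    \<open>Ack (Suc l)\<close> of scaled weight \<open>s\<close>.\<close>
  define bet where "bet = rec_nat C (\<lambda>i x. rho * x - (if i = 0 then s else eta))"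
  define b where "b = (\<lambda>k. bet (p - 1 - k))"
  define Gam where "Gam = bet p"
  define sig where "sig = s / Gam"
  define tip where "tip = (\<lambda>k. if Suc k = p then s else eta)"
  have bet_Suc: "bet (Suc i) = rho * bet i - (if i = 0 then s else eta)" for i by (simp add: bet_def)
  have bet_0: "bet 0 = C" by (simp add: bet_def)
  have rho_s: "rho * s = eta * th / 2" using rho_less by (simp add: s_def)
  have s: "0 < s" "s \<le> eta * th / 2" "s \<le> eta"
  proof -
    show s0: "0 < s" using eta th rho_less by (simp add: s_def)
    have "1 * s \<le> rho * s" using s0 rho_less by (intro mult_right_mono) auto
    then show s2: "s \<le> eta * th / 2" using rho_s by linarith
    have "eta * th \<le> eta * 1" using eta th kap by (intro mult_left_mono) auto
    then show "s \<le> eta" using s2 eta by linarith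
  qed
  have a_pos: "0 < a k" for k using eta rho_less by (simp add: a_def)
  have a_le: "a k \<le> eta * D" for k
    unfolding a_def D_def using eta rho_less by (intro mult_left_mono power_increasing) auto
  have eta_le_a: "eta \<le> a k" for k
    unfolding a_def using eta rho_less one_le_power[of "2 * rho" "p - k"] by simp
  define A where "A = sum a {..<p}"
  have A: "A \<le> real p * (eta * D)"
    unfolding A_def using sum_bounded_above[of "{..<p}" a "eta * D"] a_le by simp
  have a_le_A: "a k \<le> A" if "k < p" for k
    unfolding A_def using that a_pos by (intro member_le_sum) (auto simp: less_imp_le)
  have A_pos: "0 < A" using a_le_A[of 0] a_pos[of 0] p3 by linarith
  have main: "(1 + rho ^ p * C) * (rho * A) \<le> mu"
  proof -
    have nz: "0 < (1 + rho ^ p * C) * real p * D * rho"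
      using C D rho_less p3 by (intro mult_pos_pos add_pos_pos) auto
    have "(1 + rho ^ p * C) * (rho * A) \<le> (1 + rho ^ p * C) * (rho * (real p * (eta * D)))"
      using A C rho_less by (intro mult_left_mono) (auto intro!: add_nonneg_nonneg mult_nonneg_nonneg)
    also have "\<dots> = eta * ((1 + rho ^ p * C) * real p * D * rho)" by (simp only: mult_ac)
    also have "\<dots> = mu" using nz unfolding eta_def by (metis less_irrefl nonzero_eq_divide_eq)
    finally show ?thesis .
  qed
  have one_le: "1 \<le> 1 + rho ^ p * C" using C rho_less by (auto intro!: mult_nonneg_nonneg)
  have rhoA: "rho * A \<le> mu"
    using main mult_right_mono[OF one_le, of "rho * A"] mult_pos_pos[of rho A] A_pos rho_less by linarith
  have A_mu: "A \<le> mu" using rhoA mult_right_mono[of 1 rho A] A_pos rho_less by linarith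
  have eta_lam: "eta \<le> lam" using eta_le_a[of 0] a_le_A[of 0] A_mu mu p3 by linarith
  \<comment> \<open>The factor \<open>rho\<close> exceeds 1 by \<open>lam / kap\<close>; on weights
    of at least \<open>C\<close> this pays for both \<open>tip\<close> and
    \<open>sig\<close>.\<close>
  have slack: "2 * eta \<le> (rho - 1) * x" if "C \<le> x" for x
  proof -
    have "rho - 1 = lam / kap" using kap by (simp add: rho_def field_simps)
    moreover have "lam \<le> lam / kap" using kap lam by (simp add: field_simps)
    ultimately have "eta * 2 \<le> (rho - 1) * x"
      using eta eta_lam that C rho_less by (intro mult_mono) auto
    then show ?thesis by simp
  qed
  have bet_ge: "C \<le> bet i" for i
  proof (induction i)
    case (Suc i)
    have "rho * bet i - bet i \<ge> 2 * eta" using slack[OF Suc] by (simp add: algebra_simps)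
    moreover have "(if i = 0 then s else eta) \<le> eta" using s by simp
    ultimately show ?case unfolding bet_Suc using Suc eta by linarith
  qed (simp add: bet_0)
  have bet_le: "bet i \<le> rho ^ i * C" for i
  proof (induction i)
    case (Suc i)
    have "rho * bet i \<le> rho * (rho ^ i * C)" using Suc rho_less by simp
    moreover have "0 \<le> (if i = 0 then s else eta)" using s eta by simp
    ultimately show ?case unfolding bet_Suc power_Suc mult.assoc by linarith
  qed (simp add: bet_0)
  have Gam: "1 \<le> Gam" "C \<le> Gam" "Gam \<le> rho ^ p * C" "0 < Gam"
    using bet_ge[of p] bet_le[of p] C rho_less by (auto simp: Gam_def)
  have sig: "0 < sig" "sig \<le> s" "Gam * sig = s"
    using s Gam by (auto simp: sig_def field_simps)
  have inn: "(if k = 0 then Gam else b (k - 1)) = rho * b k - tip k" if "k < p" for k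
  proof -
    have "(if k = 0 then Gam else b (k - 1)) = bet (Suc (p - 1 - k))"
      using that p3 by (auto simp: Gam_def b_def intro!: arg_cong[of _ _ bet])
    moreover have "p - 1 - k = 0 \<longleftrightarrow> Suc k = p" using that by auto
    ultimately show ?thesis unfolding bet_Suc by (simp add: b_def tip_def)
  qed
  have b_ge: "C \<le> b k" for k by (simp add: b_def bet_ge)
  have tip: "(if Suc k = p then Gam * sig else eta) = tip k" "sig \<le> tip k" "tip k \<le> eta" for k
    using sig s by (auto simp: tip_def)
  have "gear_train p kap Gam eta sig a b L" if "0 < L" for L
  proof
    show "3 \<le> p" "0 < kap" "kap < 1 / 2" "0 < L" "0 < Gam" "0 < eta" "0 < sig"
      using p3 kap that Gam eta sig by auto
    show "0 < a k" "0 < b k" for k using a_pos b_ge[of k] C rho_less by auto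
  next
    fix k assume k: "k < p"
    have "kap * (rho * b k - tip k + b k + tip k + sig) = (kap * (rho + 1)) * b k + kap * sig"
      by (simp add: algebra_simps)
    then have W: "kap * (rho * b k - tip k + b k + tip k + sig) = b k + kap * sig" using rho1 by simp
    have "kap * sig < 1 * sig" using kap sig by (intro mult_strict_right_mono) auto
    moreover have "0 < kap * sig" using kap sig by simp
    moreover have "b k + sig \<le> rho * b k - tip k"
      using slack[OF b_ge[of k]] tip(2,3)[of k] by (simp add: algebra_simps)
    ultimately show "b k \<le> kap * ((if k = 0 then Gam else b (k - 1)) + b k + (if Suc k = p then Gam * sig else eta) + sig) \<and>
      kap * ((if k = 0 then Gam else b (k - 1)) + b k + (if Suc k = p then Gam * sig else eta) + sig) < b k + sig \<and>
      sig \<le> (if Suc k = p then Gam * sig else eta) \<and>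
      b k + sig \<le> (if k = 0 then Gam else b (k - 1))"
      unfolding inn[OF k] tip(1) W using tip(2) by simp
  next
    fix k assume k: "k < p"
    have "rho * (eta + (if Suc k < p then a (Suc k) else 0)) \<le> a k"
    proof (cases "Suc k < p")
      case True
      have "p - k = Suc (p - Suc k)" using k by simp
      then have "a k = rho * (2 * a (Suc k))" by (simp add: a_def)
      then show ?thesis using True eta_le_a[of "Suc k"] rho_less by simp
    next
      case False
      then have "p - k = 1" using k by simp
      then have "a k = rho * (2 * eta)" by (simp add: a_def)
      then show ?thesis using False eta rho_less by simp
    qed
    then show "eta + (if Suc k < p then a (Suc k) else 0) \<le> kap * (a k + (eta + (if Suc k < p then a (Suc k) else 0)))"
      by (rule dominated)
    have "k - 1 < p" using k by simp
    from a_le_A[OF this] have "a (k - 1) \<le> 1" using A_mu mu lam by linarith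
    then have "1 + (if k = 0 then 1 else a (k - 1)) \<le> 2" by simp
    then have "rho * (1 + (if k = 0 then 1 else a (k - 1))) \<le> rho * 2"
      using rho_less by (intro mult_left_mono) auto
    also have "\<dots> \<le> b k" using b_ge[of k] C rho_less by simp
    finally show "1 + (if k = 0 then 1 else a (k - 1)) \<le> kap * (b k + (1 + (if k = 0 then 1 else a (k - 1))))"
      by (rule dominated)
  next
    show "Gam * sig \<le> kap * (eta + Gam * sig)"
    proof (rule dominated)
      have "eta * th \<le> eta * 1" using eta th kap by (intro mult_left_mono) auto
      then show "rho * (Gam * sig) \<le> eta" unfolding sig(3) rho_s using eta by linarith
    qed
  next
    fix x assume x: "x \<in> {a 0 / Gam, sig}"
    have "a 0 / Gam \<le> eta * th / 2"
    proof -
      have "a 0 = eta * D" by (simp add: a_def D_def)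
      also have "\<dots> = C * (eta * th / 2)" using th by (simp add: C_def)
      also have "\<dots> \<le> Gam * (eta * th / 2)" using Gam eta th by (intro mult_right_mono) auto
      finally show ?thesis using Gam by (simp add: field_simps)
    qed
    moreover have "sig \<le> eta * th / 2" using s(2) sig(2) by linarith
    ultimately have "x \<le> eta * th / 2" using x by blast
    then have y: "s + x \<le> eta * th" using s(2) by linarith
    have x_pos: "0 < s + x" using x a_pos[of 0] Gam sig s by (auto intro: add_pos_pos)
    have W: "kap * (real p * eta + (s + x)) = eta + eta * th + kap * (s + x)"
      by (simp add: th_def algebra_simps)
    have "0 \<le> kap * (s + x)" using kap x_pos by simp
    moreover have "kap * (s + x) \<le> 1 / 2 * (eta * th)" using kap y x_pos by (intro mult_mono) auto
    moreover have "eta * th \<le> eta * (1 / 2)" using eta th kap by (intro mult_left_mono) auto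
    ultimately show "eta + (Gam * sig + x) \<le> kap * (p * eta + (Gam * sig + x)) \<and>
        kap * (p * eta + (Gam * sig + x)) < 2 * eta"
      unfolding sig(3) W using y eta by linarith
  next
    fix x assume x: "x \<in> {a (p - 1), a (p - 1) + Gam * sum a {..<p}}"
    have "a (p - 1) \<le> A" using a_le_A p3 by simp
    then have "x \<le> (1 + Gam) * A"
      using x A_pos Gam by (auto simp: A_def[symmetric] algebra_simps intro: add_increasing2)
    also have "\<dots> \<le> (1 + rho ^ p * C) * (rho * A)"
      using Gam A_pos rho_less by (intro mult_mono) auto
    finally have xm: "x \<le> mu" using main by linarith
    have x0: "0 \<le> x" using x a_pos[of "p - 1"] Gam A_pos by (auto simp: A_def[symmetric] intro!: add_nonneg_nonneg)
    have kx: "0 \<le> kap * x" "kap * x \<le> 1 / 2 * lam"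
      using kap x0 xm mu lam by (simp, intro mult_mono) auto
    have "kap * (2 + x) = 2 * kap + kap * x" by (simp add: algebra_simps)
    then show "x \<le> kap * (2 + x) \<and> kap * (2 + x) < 1"
      using kx xm mu kap lam by linarith
  next
    show "sum a {..<p} \<le> kap * (1 + sum a {..<p})"
      using rhoA mu lam by (intro dominated) (simp add: A_def)
  qed
  then show ?thesis using that unfolding kap_def by blast
qed

section \<open>Asymptotics and final assembly\<close>

lemma two_to_bigthetaI:
  fixes T :: "nat \<Rightarrow> nat" and n :: "nat \<Rightarrow> nat" and g :: real
  assumes g: "1 < g" and lower: "\<And>k. 2 * g ^ k \<le> real (T k)" and upper: "\<And>k. T k \<le> 2 ^ n k"
    and n: "\<And>k. n k \<le> (k + 1) * q" and q: "0 < q"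
  shows "two_to_bigtheta (\<lambda>k. enat (T k)) n"
proof -
  define f where "f = (\<lambda>k. log 2 (real (T k)))"
  define d where "d = min 1 (log 2 g)"
  have d: "0 < d" using g by (simp add: d_def)
  have T_pos: "0 < real (T k)" for k
    using lower[of k] g by (smt (verit) zero_less_power)
  \<comment> \<open>The factor 2 in the lower bound provides the summand 1, so the bound is a
    multiple of \<open>k + 1\<close>, like the bound on \<open>n k\<close>, even at
    \<open>k = 0\<close>.\<close>
  have f_lower: "d * (k + 1) \<le> f k" for k
  proof -
    have "log 2 (2 * g ^ k) \<le> f k"
      unfolding f_def using lower[of k] g T_pos[of k] by (subst log_le_cancel_iff) auto
    moreover have "log 2 (2 * g ^ k) = 1 + k * log 2 g"
      using g by (simp add: log_mult log_nat_power)
    moreover have "k * d \<le> k * log 2 g" by (intro mult_left_mono) (auto simp: d_def)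
    moreover have "d \<le> 1" by (simp add: d_def)
    ultimately show ?thesis by (simp add: algebra_simps)
  qed
  have f_upper: "f k \<le> real (n k)" for k
  proof -
    have "real (T k) \<le> 2 ^ n k" using upper[of k] of_nat_le_iff[of "T k" "2 ^ n k", where 'a = real] by simp
    then have "f k \<le> log 2 (2 ^ n k)"
      unfolding f_def using T_pos[of k] by (subst log_le_cancel_iff) auto
    then show ?thesis by simp
  qed
  have f_nonneg: "0 \<le> f k" for k
    using f_lower[of k] d by (smt (verit) mult_nonneg_nonneg of_nat_0_le_iff)
  have "f \<in> \<Theta>(\<lambda>k. real (n k))"
  proof (rule bigthetaI)
    show "f \<in> O(\<lambda>k. real (n k))"
      using f_upper f_nonneg by (intro bigoI[of _ 1] always_eventually) auto
    show "f \<in> \<Omega>(\<lambda>k. real (n k))"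
    proof (rule landau_omega.bigI[of "d / q"])
      show "0 < d / q" using d q by simp
      have "d / q * real (n k) \<le> f k" for k
      proof -
        have "real (n k) \<le> real ((k + 1) * q)" using n[of k] by (simp only: of_nat_le_iff)
        then have "real (n k) \<le> (real k + 1) * q" by (simp add: algebra_simps)
        then have "d / q * real (n k) \<le> d / q * ((real k + 1) * q)"
          using d q by (intro mult_left_mono) auto
        also have "\<dots> = d * (real k + 1)" using q by (simp add: field_simps)
        finally show ?thesis using f_lower[of k] by linarith
      qed
      then show "\<forall>\<^sub>F k in at_top. d / q * norm (real (n k)) \<le> norm (f k)"
        using f_nonneg by (intro always_eventually) auto
    qed
  qed
  moreover have "ereal_of_enat (enat (T k)) = ereal (2 powr f k)" for k
    using T_pos[of k] by (simp add: f_def)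
  ultimately show ?thesis unfolding two_to_bigtheta_def by blast
qed

theorem theorem2:
  fixes lam :: real
  assumes "0 < lam" and "lam < 1"
  shows "\<exists>(V :: nat \<Rightarrow> nat set) (E :: nat \<Rightarrow> nat set set)
            (w :: nat \<Rightarrow> nat \<Rightarrow> real) (C0 :: nat \<Rightarrow> nat \<Rightarrow> color).
           (\<forall>k. simple_graph (V k) (E k)) \<and>
           (\<forall>k. \<forall>v \<in> V k. w k v > 0) \<and>
           filterlim (\<lambda>k. card (V k)) at_top at_top \<and>
           (\<lambda>k. real (card (E k))) \<in> O(\<lambda>k. real (card (V k))) \<and>
           two_to_bigtheta (\<lambda>k. stabilization_time SB (V k) (E k) (w k) lam (C0 k)) (\<lambda>k. card (V k)) \<and>
           two_to_bigtheta (\<lambda>k. stabilization_time CB (V k) (E k) (w k) lam (C0 k)) (\<lambda>k. card (V k))"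
proof -
  obtain p Gam eta sig a b
    where gt: "\<And>L. 0 < L \<Longrightarrow> gear_train p ((1 - lam) / 2) Gam eta sig a b L"
    using gear_weights_exist[OF assms] by metis
  have gear: "gear_train p ((1 - lam) / 2) Gam eta sig a b (Suc k)" for k using gt by simp
  have ring: "ring_phase p" using gear[of 0] by (simp add: gear_train_def)
  then have p3: "3 \<le> p" by (simp add: ring_phase_def)
  let ?wt = "wt Gam a b eta sig"
  let ?init = "coloring (ring_phase.initial_count p)"
  \<comment> \<open>\<open>Suc k\<close> rings keep the number of rings positive;
    \<open>to_nat\<close> moves the nodes into the natural numbers.\<close>
  define V where "V = (\<lambda>k. (to_nat :: node \<Rightarrow> nat) ` verts p (Suc k))"
  define E where "E = (\<lambda>k. (`) (to_nat :: node \<Rightarrow> nat) ` edges p (Suc k))"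
  define w where "w = (\<lambda>k::nat. ?wt \<circ> (from_nat :: nat \<Rightarrow> node))"
  define C0 where "C0 = (\<lambda>k::nat. ?init \<circ> (from_nat :: nat \<Rightarrow> node))"
  have w: "w k \<circ> to_nat = ?wt" and C0: "C0 k \<circ> to_nat = ?init" for k
    by (auto simp: w_def C0_def)
  have inj: "inj (to_nat :: node \<Rightarrow> nat)" by simp
  have graph: "simple_graph (V k) (E k)" for k
    unfolding V_def E_def by (intro simple_graph_image inj simple_graph_edges)
  have pos: "0 < w k v" for k v
    unfolding w_def using gear_train.w_pos[OF gear] by simp
  have nonempty: "neighborhood (E k) v \<noteq> {}" if v: "v \<in> V k" for k v
  proof -
    obtain u :: node where u: "v = to_nat u" "u \<in> verts p (Suc k)" using v by (auto simp: V_def)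
    then show ?thesis
      using nbrs_nonempty[OF u(2)] p3 by (simp add: E_def neighborhood_image neighborhood_edges)
  qed
  define g where "g = real p / real (p - 2)"
  have g: "1 < g" using p3 by (simp add: g_def field_simps)
  have lam2: "1 - 2 * ((1 - lam) / 2) = lam" by (simp add: field_simps)
  have lower: "2 * g ^ k \<le> real T"
    if "minority_run CB (V k) (E k) (w k) lam (C0 k) T S" "stable (V k) (E k) (w k) lam (S T)" for k T S
  proof -
    have "minority_run CB (verts p (Suc k)) (edges p (Suc k)) ?wt lam ?init T (\<lambda>i. S i \<circ> to_nat)"
      using minority_run_image[OF inj] that(1) w C0 unfolding V_def E_def by metis
    moreover have "stable (verts p (Suc k)) (edges p (Suc k)) ?wt lam (S T \<circ> to_nat)"
      using stable_image[OF inj] that(2) w unfolding V_def E_def by metis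
    ultimately show ?thesis
      using gear_train.stabilization_lower_bound[OF gear[of k], where M = CB and T = T
          and S = "\<lambda>i. S i \<circ> to_nat", unfolded lam2]
      by (simp add: g_def)
  qed
  have cardV: "card (V k) = card (verts p (Suc k))" for k
    unfolding V_def by (intro card_image inj_on_subset[OF inj]) simp
  have V_le: "card (V k) \<le> (k + 1) * (6 * p + 6)" for k
  proof -
    have "card (V k) \<le> (k + 2) * (3 * p + 3)" using card_verts_le[of p "Suc k"] cardV by simp
    also have "\<dots> \<le> (2 * (k + 1)) * (3 * p + 3)" by (intro mult_right_mono) auto
    finally show ?thesis by (simp add: algebra_simps)
  qed
  have V_ge: "k + 2 \<le> card (V k)" for k using card_verts_ge[of "Suc k" p] cardV by simp
  have theta: "two_to_bigtheta (\<lambda>k. stabilization_time M (V k) (E k) (w k) lam (C0 k)) (\<lambda>k. card (V k))" for M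
  proof -
    have "\<exists>T. stabilization_time M (V k) (E k) (w k) lam (C0 k) = enat T \<and>
        2 * g ^ k \<le> real T \<and> T \<le> 2 ^ card (V k)" for k
      by (rule stabilization_time_bounds[OF graph pos assms(1) nonempty lower])
    then obtain T where T: "\<And>k. stabilization_time M (V k) (E k) (w k) lam (C0 k) = enat (T k)"
        "\<And>k. 2 * g ^ k \<le> real (T k)" "\<And>k. T k \<le> 2 ^ card (V k)"
      by metis
    show ?thesis unfolding T(1) using g T(2,3) V_le by (rule two_to_bigthetaI) simp
  qed
  have "filterlim (\<lambda>k. card (V k)) at_top at_top"
  proof (rule filterlim_at_top_mono[OF filterlim_ident])
    show "\<forall>\<^sub>F k in at_top. k \<le> card (V k)" using V_ge by (intro always_eventually allI) (metis add_leD1)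
  qed
  moreover have "(\<lambda>k. real (card (E k))) \<in> O(\<lambda>k. real (card (V k)))"
  proof (rule bigoI[of _ "2 ^ (6 * p + 6)"])
    have "card (E k) \<le> card (V k) * 2 ^ (6 * p + 6)" for k
    proof -
      have "card (E k) \<le> card (edges p (Suc k))"
        unfolding E_def by (rule card_image_le[OF finite_edges])
      also have "\<dots> \<le> (k + 2) * 2 ^ (6 * p + 6)" using card_edges_le[of p "Suc k"] by simp
      also have "\<dots> \<le> card (V k) * 2 ^ (6 * p + 6)" using V_ge by (intro mult_right_mono) auto
      finally show ?thesis .
    qed
    then have "real (card (E k)) \<le> 2 ^ (6 * p + 6) * real (card (V k))" for k
      using of_nat_mono[of "card (E k)" "card (V k) * 2 ^ (6 * p + 6)", where 'a = real]
      by (simp add: mult.commute)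
    then show "\<forall>\<^sub>F k in at_top. norm (real (card (E k))) \<le> 2 ^ (6 * p + 6) * norm (real (card (V k)))"
      by (intro always_eventually) auto
  qed
  ultimately show ?thesis
    using graph pos theta by (intro exI[of _ V] exI[of _ E] exI[of _ w] exI[of _ C0] conjI allI ballI) auto
qed

end
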